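(* Let $\mathcal{H}$ be a separable complex Hilbert space and let $\Omega \subseteq \mathcal{H}$ be a bounded convex domain. Fix a point $p \in \Omega$. Let $f:\Omega \rightarrow \Omega$ be a holomorphic mapping such that (a) $f(p) = p$; (b) the differential $df_p$ is triangularizable; (c) $\sigma(df_p) \subseteq S^1$. Then $f$ is a biholomorphic mapping of $\Omega$ onto itself.
   Context: A domain is a nonempty connected open set. $S^1$ is the unit circle in $\mathbb{C}$. For a holomorphic mapping $f$ between domains in $\mathcal{H}$, the differential at a point $p$ is the bounded linear operator on $\mathcal{H}$ given by $df_p(v) = \lim_{\mathbb{C}\ni h \to 0} \frac{f(p+hv)-f(p)}{h}$. For a bounded linear operator $T$ on $\mathcal{H}$, $\sigma(T) = \{\lambda\in\mathbb{C} : T-\lambda I \text{ is not invertible}\}$ is its spectrum. A bounded linear operator $T:\mathcal{H}\to\mathcal{H}$ is called triangularizable if there exists a basis $\{e_1,e_2,\ldots\}$ of $\mathcal{H}$ such that $T(\mathbb{C}e_1+\cdots+\mathbb{C}e_N)\subset \mathbb{C}e_1+\cdots+\mathbb{C}e_N$ for every positive integer $N$; the basis can always be taken to be orthonormal (the Gram-Schmidt process preserves the flags $\mathbb{C}e_1+\cdots+\mathbb{C}e_N$). A biholomorphic mapping is a holomorphic bijection whose inverse is holomorphic. *)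

theory Defs
  imports "HOL-Analysis.Analysis" "HOL-Library.Extended_Nat"
begin

text \<open>
  Complex inner product spaces are built on top of \<^class>\<open>real_inner\<close>: the real inner product is
  the real part of the Hermitian one, so norm, topology, derivatives and convexity are those of
  the library. The Hermitian product is linear in its first argument.
\<close>

class complex_inner = real_inner +
  fixes scaleC :: "complex \<Rightarrow> 'a \<Rightarrow> 'a" (infixr \<open>*\<^sub>C\<close> 75)
    and cinner :: "'a \<Rightarrow> 'a \<Rightarrow> complex"
  assumes scaleC_add_right: "a *\<^sub>C (x + y) = a *\<^sub>C x + a *\<^sub>C y"
    and scaleC_add_left: "(a + b) *\<^sub>C x = a *\<^sub>C x + b *\<^sub>C x"
    and scaleC_scaleC: "a *\<^sub>C b *\<^sub>C x = (a * b) *\<^sub>C x"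
    and scaleC_one: "1 *\<^sub>C x = x"
    and scaleR_scaleC: "r *\<^sub>R x = complex_of_real r *\<^sub>C x"
    and cinner_commute: "cinner x y = cnj (cinner y x)"
    and cinner_add_left: "cinner (x + y) z = cinner x z + cinner y z"
    and cinner_scaleC_left: "cinner (a *\<^sub>C x) y = a * cinner x y"
    and inner_eq_Re_cinner: "inner x y = Re (cinner x y)"

class chilbert_space = complex_inner + complete_space
begin
subclass banach ..
end

instantiation complex :: chilbert_space
begin
definition "scaleC a x = a * (x :: complex)"
definition "cinner x y = x * cnj (y :: complex)"
instance
  by standard (auto simp: scaleC_complex_def cinner_complex_def algebra_simps
      scaleR_conv_of_real inner_complex_def)
end

definition bounded_clinear :: "('a::complex_inner \<Rightarrow> 'a) \<Rightarrow> bool" where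
  "bounded_clinear T \<longleftrightarrow> bounded_linear T \<and> (\<forall>c x. T (c *\<^sub>C x) = c *\<^sub>C T x)"

definition op_invertible :: "('a::complex_inner \<Rightarrow> 'a) \<Rightarrow> bool" where
  "op_invertible T \<longleftrightarrow> (\<exists>S. bounded_clinear S \<and> S \<circ> T = id \<and> T \<circ> S = id)"

definition op_spectrum :: "('a::complex_inner \<Rightarrow> 'a) \<Rightarrow> complex set" where
  "op_spectrum T = {\<mu>. \<not> op_invertible (\<lambda>x. T x - \<mu> *\<^sub>C x)}"

text \<open>
  A (Schauder) basis \<open>e 0, e 1, \<dots>\<close> of length \<open>d\<close>, where \<open>d = \<infinity>\<close> in the infinite-dimensional case.
  For finite \<open>d\<close> the entries \<open>e n\<close> with \<open>n \<ge> d\<close> are irrelevant and this is an ordinary linear basis.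
\<close>

definition is_basis :: "enat \<Rightarrow> (nat \<Rightarrow> 'a::complex_inner) \<Rightarrow> bool" where
  "is_basis d e \<longleftrightarrow>
     (\<forall>x. \<exists>!c. (\<forall>n. d \<le> enat n \<longrightarrow> c n = 0) \<and> (\<lambda>n. c n *\<^sub>C e n) sums x)"

definition flag :: "(nat \<Rightarrow> 'a::complex_inner) \<Rightarrow> nat \<Rightarrow> 'a set" where
  "flag e N = {\<Sum>n<N. c n *\<^sub>C e n | c. True}"

definition triangularizable :: "('a::complex_inner \<Rightarrow> 'a) \<Rightarrow> bool" where
  "triangularizable T \<longleftrightarrow>
     (\<exists>d e. is_basis d e \<and> (\<forall>N\<ge>1. enat N \<le> d \<longrightarrow> T ` flag e N \<subseteq> flag e N))"

text \<open>Complex Frechet differentiability at every point; the sets of interest are open.\<close>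

definition hilbert_holomorphic_on :: "('a::complex_inner \<Rightarrow> 'a) \<Rightarrow> 'a set \<Rightarrow> bool"
    (infixl \<open>hilbert'_holomorphic'_on\<close> 50) where
  "f hilbert_holomorphic_on S \<longleftrightarrow>
     (\<forall>x\<in>S. \<exists>D. bounded_clinear D \<and> (f has_derivative D) (at x within S))"

definition differential :: "('a::complex_inner \<Rightarrow> 'a) \<Rightarrow> 'a \<Rightarrow> 'a \<Rightarrow> 'a" where
  "differential f p v = Lim (at 0) (\<lambda>h::complex. inverse h *\<^sub>C (f (p + h *\<^sub>C v) - f p))"

definition biholomorphic :: "('a::complex_inner \<Rightarrow> 'a) \<Rightarrow> 'a set \<Rightarrow> 'a set \<Rightarrow> bool" where
  "biholomorphic f A B \<longleftrightarrow>
     f hilbert_holomorphic_on A \<and> bij_betw f A B \<and> inv_into A f hilbert_holomorphic_on B"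

end

theory Submission
  imports Defs "HOL-Complex_Analysis.Cauchy_Integral_Formula"
begin

text \<open>
  By the Cauchy estimates the derivative \<open>T\<close> of \<open>f\<close> at \<open>p\<close> is power bounded. Triangularity then makes its
  eigenvectors span a dense subspace, their eigenvalues are unimodular, and so \<open>T\<^sup>n \<rightarrow> I\<close> strongly along some
  sequence of exponents \<open>n\<close>; in particular \<open>S = T\<inverse>\<close> is power bounded as well. Averages of the maps
  \<open>S\<^sup>i (f\<^sup>i - p)\<close> almost conjugate \<open>f\<close> to \<open>T\<close> near \<open>p\<close>, so the orbits of \<open>f\<close> near \<open>p\<close> are as recurrent as
  those of \<open>T\<close>: along the same sequence \<open>f\<^sup>n \<rightarrow> id\<close> and \<open>f\<^bsup>n-1\<^esup>\<close> converges, first near \<open>p\<close> and then, by a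
  Vitali argument, on all of \<open>\<Omega>\<close>. The limit \<open>h\<close> of \<open>f\<^bsup>n-1\<^esup>\<close> is holomorphic with values in the closure of
  \<open>\<Omega>\<close>; convexity and the maximum principle force them into \<open>\<Omega>\<close>, and \<open>h\<close> is the inverse of \<open>f\<close>.
\<close>

section \<open>Complex inner product spaces\<close>

text \<open>In infinite dimension closed balls are not compact and Montel's theorem fails: a
  sequence of iterates may have no pointwise convergent subsequence. Convergence is therefore
  imported from the linear model \<open>T\<close>, and every limit below is pointwise in norm.
  Bounded powers and spectrum in the unit circle alone would not give recurrence: the bilateral
  shift is unitary, yet its powers tend weakly to 0. Triangularity supplies the eigenvectors; the
  uniform bound on the powers then forbids Jordan blocks and extends recurrence from the span of the
  eigenvectors to its closure. The averages have derivative the identity at \<open>p\<close>, and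
  near \<open>p\<close> they change distances by factors between 1/2 and 3/2, uniformly in the
  number of terms. This lower bound lets small differences along a linear orbit be read back as
  small differences along an orbit of \<open>f\<close>, at first only near \<open>p\<close>. The
  exponents \<open>n - 1\<close> appear because one more application of \<open>f\<close>, before or
  after, gives the recurrent iterate, so the limit inverts \<open>f\<close> on both sides.\<close>

lemma scaleC_zero_left [simp]: "0 *\<^sub>C (x::'a::complex_inner) = 0"
  using scaleC_add_left[of 0 0 x] by simp

lemma scaleC_zero_right [simp]: "c *\<^sub>C (0::'a::complex_inner) = 0"
  using scaleC_add_right[of c 0 "0::'a"] by simp

lemma scaleC_minus_left: "(- c) *\<^sub>C (x::'a::complex_inner) = - (c *\<^sub>C x)"
  using scaleC_add_left[of c "- c" x] by (simp add: eq_neg_iff_add_eq_0 add.commute)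

lemma scaleC_minus_right: "c *\<^sub>C (- x::'a::complex_inner) = - (c *\<^sub>C x)"
  using scaleC_add_right[of c x "- x"] by (simp add: eq_neg_iff_add_eq_0 add.commute)

lemma scaleC_diff_left: "(b - c) *\<^sub>C (x::'a::complex_inner) = b *\<^sub>C x - c *\<^sub>C x"
  using scaleC_add_left[of b "- c" x] by (simp add: scaleC_minus_left)

lemma scaleC_diff_right: "c *\<^sub>C (x - y::'a::complex_inner) = c *\<^sub>C x - c *\<^sub>C y"
  using scaleC_add_right[of c x "- y"] by (simp add: scaleC_minus_right)

lemma scaleC_sum_right: "c *\<^sub>C sum f A = (\<Sum>i\<in>A. c *\<^sub>C (f i::'a::complex_inner))"
  by (induction A rule: infinite_finite_induct) (auto simp: scaleC_add_right)

lemma cinner_scaleC_right: "cinner (x::'a::complex_inner) (c *\<^sub>C y) = cnj c * cinner x y"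
  by (metis cinner_commute cinner_scaleC_left complex_cnj_mult)

lemma cinner_zero_left [simp]: "cinner 0 (x::'a::complex_inner) = 0"
  using cinner_add_left[of 0 0 x] by simp

lemma cinner_minus_left: "cinner (- x) (y::'a::complex_inner) = - cinner x y"
  using cinner_add_left[of x "- x" y] by (simp add: eq_neg_iff_add_eq_0 add.commute)

lemma cinner_diff_left: "cinner (x - y) (z::'a::complex_inner) = cinner x z - cinner y z"
  using cinner_add_left[of x "- y" z] by (simp add: cinner_minus_left)

lemma cinner_sum_left: "cinner (sum f A) (y::'a::complex_inner) = (\<Sum>i\<in>A. cinner (f i) y)"
  by (induction A rule: infinite_finite_induct) (auto simp: cinner_add_left)

lemma cinner_self: "cinner x x = of_real ((norm (x::'a::complex_inner))\<^sup>2)"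
proof -
  have "Im (cinner x x) = 0"
    using cinner_commute[of x x] by (metis Reals_cnj_iff complex_is_Real_iff)
  moreover have "Re (cinner x x) = (norm x)\<^sup>2"
    by (simp add: inner_eq_Re_cinner[symmetric] power2_norm_eq_inner)
  ultimately show ?thesis
    by (simp add: complex_eq_iff)
qed

lemma norm_scaleC [simp]: "norm (c *\<^sub>C (x::'a::complex_inner)) = norm c * norm x"
proof -
  have "complex_of_real ((norm (c *\<^sub>C x))\<^sup>2) = c * cnj c * cinner x x"
    unfolding cinner_self[symmetric] by (simp add: cinner_scaleC_left cinner_scaleC_right)
  also have "\<dots> = complex_of_real ((norm c * norm x)\<^sup>2)"
    by (simp add: cinner_self complex_norm_square[symmetric] power_mult_distrib)
  finally have "(norm (c *\<^sub>C x))\<^sup>2 = (norm c * norm x)\<^sup>2"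
    using of_real_eq_iff by blast
  then show ?thesis
    by (metis mult_nonneg_nonneg norm_ge_zero power2_eq_imp_eq)
qed

lemma norm_cinner_le: "norm (cinner x y) \<le> norm (x::'a::complex_inner) * norm y"
proof (cases "cinner x y = 0")
  case False
  \<comment> \<open>Rotating \<open>x\<close> by this phase makes the Hermitian product real and
    nonnegative, so the real Cauchy-Schwarz inequality loses nothing.\<close>
  define c where "c = cnj (sgn (cinner x y))"
  have c: "norm c = 1" "c * cinner x y = of_real (norm (cinner x y))"
    using False by (simp_all add: c_def sgn_eq norm_divide divide_simps complex_norm_square[symmetric]
        power2_eq_square mult.commute[of "cnj _"])
  have "norm (cinner x y) = inner (c *\<^sub>C x) y"
    by (simp add: inner_eq_Re_cinner cinner_scaleC_left c)
  also have "\<dots> \<le> norm (c *\<^sub>C x) * norm y"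
    by (rule norm_cauchy_schwarz)
  finally show ?thesis
    by (simp add: c)
qed auto

text \<open>Reduces vector-valued estimates to scalar ones that are uniform in the unit vector
  \<open>u\<close>, so that one-variable Cauchy theory applies without vector-valued integrals. The
  condition \<open>0 \<le> K\<close> covers the zero space, which has no unit vectors.\<close>

lemma norm_le_cinnerI:
  assumes "\<And>u. norm u = 1 \<Longrightarrow> norm (cinner x u) \<le> K" and "0 \<le> K"
  shows "norm (x::'a::complex_inner) \<le> K"
proof (cases "x = 0")
  case False
  define u where "u = inverse (of_real (norm x)) *\<^sub>C x"
  have "norm (cinner x u) = norm x"
    using False by (simp add: u_def cinner_scaleC_right cinner_self norm_mult norm_inverse
        power2_eq_square)
  moreover have "norm u = 1"
    using False by (simp add: u_def norm_inverse)
  ultimately show ?thesis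
    using assms(1) by metis
qed (use assms in auto)

lemma bounded_bilinear_scaleC:
  "bounded_bilinear (scaleC :: complex \<Rightarrow> 'a \<Rightarrow> 'a::complex_inner)"
proof
  show "\<exists>K. \<forall>a (b::'a). norm (a *\<^sub>C b) \<le> norm a * norm b * K"
    by (rule exI[of _ 1]) simp
qed (auto simp: scaleC_add_left scaleC_add_right scaleR_scaleC scaleC_scaleC scaleC_complex_def
    mult.commute)

lemmas bounded_linear_scaleC_left = bounded_bilinear.bounded_linear_left[OF bounded_bilinear_scaleC]
lemmas bounded_linear_scaleC_right = bounded_bilinear.bounded_linear_right[OF bounded_bilinear_scaleC]

lemma bounded_linear_cinner_left: "bounded_linear (\<lambda>x::'a::complex_inner. cinner x u)"
proof
  show "\<exists>K. \<forall>x::'a. norm (cinner x u) \<le> norm x * K"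
    using norm_cinner_le by blast
qed (auto simp: cinner_add_left scaleR_scaleC cinner_scaleC_left scaleC_complex_def)

lemma bounded_clinearD:
  assumes "bounded_clinear T"
  shows "bounded_linear T" "T (c *\<^sub>C x) = c *\<^sub>C T x"
  using assms by (auto simp: bounded_clinear_def)

section \<open>Taylor coefficients on the unit disc\<close>

text \<open>As \<open>\<phi>\<close> need not extend continuously to the closed disc, Cauchy's
  inequality is used on circles of radius \<open>r < 1\<close>, and the bound
  \<open>C / r ^ j\<close> is carried to the limit at 1.\<close>

lemma taylor_coeff_bound:
  assumes "\<phi> holomorphic_on ball 0 1" and "\<And>z. norm z < 1 \<Longrightarrow> norm (\<phi> z) \<le> C"
  shows "norm ((deriv ^^ j) \<phi> 0 / fact j) \<le> C"
proof (rule tendsto_lowerbound)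
  show "((\<lambda>r::real. C / r ^ j) \<longlongrightarrow> C) (at_left 1)"
    by (auto intro!: tendsto_eq_intros)
  have "norm ((deriv ^^ j) \<phi> 0 / fact j) \<le> C / r ^ j" if "0 < r" "r < 1" for r
  proof -
    have "norm ((deriv ^^ j) \<phi> 0) \<le> fact j * C / r ^ j"
    proof (rule Cauchy_inequality)
      show "\<phi> holomorphic_on ball 0 r"
        using assms(1) by (rule holomorphic_on_subset) (use that in auto)
      show "continuous_on (cball 0 r) \<phi>"
        using holomorphic_on_imp_continuous_on[OF assms(1)]
        by (rule continuous_on_subset) (use that in auto)
    qed (use that assms(2) in auto)
    then show ?thesis
      by (simp add: norm_divide field_simps)
  qed
  then show "\<forall>\<^sub>F r in at_left 1. norm ((deriv ^^ j) \<phi> 0 / fact j) \<le> C / r ^ j"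
    unfolding eventually_at_left_field by (intro exI[of _ 0]) auto
qed auto

text \<open>All coefficients are bounded by \<open>C\<close>, so the tail is dominated by a
  geometric series.\<close>

lemma taylor_remainder_bound:
  assumes "\<phi> holomorphic_on ball 0 1" and "\<And>z. norm z < 1 \<Longrightarrow> norm (\<phi> z) \<le> C"
    and z: "norm z < 1"
  shows "norm (\<phi> z - (\<Sum>i<n. (deriv ^^ i) \<phi> 0 / fact i * z ^ i)) \<le> C * norm z ^ n / (1 - norm z)"
proof -
  define a where "a i = (deriv ^^ i) \<phi> 0 / fact i" for i
  have a: "norm (a i) \<le> C" for i
    unfolding a_def using taylor_coeff_bound[OF assms(1,2)] .
  have "(\<lambda>i. a i * z ^ i) sums \<phi> z"
    using holomorphic_power_series[OF assms(1), of z] z by (simp add: a_def)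
  then have sums: "(\<lambda>i. a (i + n) * z ^ (i + n)) sums (\<phi> z - (\<Sum>i<n. a i * z ^ i))"
    using sums_split_initial_segment by blast
  have geo: "(\<lambda>i. C * norm z ^ n * norm z ^ i) sums (C * norm z ^ n * (1 / (1 - norm z)))"
    by (intro sums_mult geometric_sums) (use z in auto)
  have le: "norm (a (i + n) * z ^ (i + n)) \<le> C * norm z ^ n * norm z ^ i" for i
    using mult_right_mono[OF a[of "i+n"], of "norm z ^ (i+n)"]
    by (simp add: norm_mult norm_power power_add mult_ac)
  have "norm (\<Sum>i. a (i + n) * z ^ (i + n)) \<le> (\<Sum>i. C * norm z ^ n * norm z ^ i)"
    by (rule norm_suminf_le[OF le]) (use geo in \<open>auto simp: sums_iff\<close>)
  then show ?thesis
    using sums geo by (simp add: sums_iff a_def)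
qed

text \<open>The summand is the \<open>l\<close>-th power of one \<open>n\<close>-th root of unity
  \<open>q\<close>, which differs from 1 for \<open>i \<noteq> j\<close> because both indices lie
  below \<open>n\<close>; its geometric sum then vanishes.\<close>

lemma roots_of_unity_orthogonal:
  assumes "i < n" "j < n"
  shows "(\<Sum>l<n. cis (2 * pi / n) ^ (l * i) * cis (- (2 * pi / n)) ^ (l * j)) = (if i = j then of_nat n else 0)"
proof -
  define q where "q = cis (2 * pi * (real i - real j) / n)"
  have n: "n > 0" using assms by auto
  have *: "cis (2 * pi / n) ^ (l * i) * cis (- (2 * pi / n)) ^ (l * j) = q ^ l" for l
    using n by (simp add: q_def Complex.DeMoivre cis_mult field_simps)
  have "q ^ n = 1"
  proof -
    have "real n * (2 * pi * (real i - real j) / n) = 2 * pi * real i + - (2 * pi * real j)"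
      using n by (simp add: right_diff_distrib diff_divide_distrib)
    then have "q ^ n = cis (2 * pi * real i + - (2 * pi * real j))"
      by (simp only: q_def Complex.DeMoivre)
    also have "\<dots> = 1"
      by (simp only: cis_mult[symmetric] cis_inverse[symmetric]) (simp add: cis_multiple_2pi)
    finally show ?thesis .
  qed
  moreover have "q \<noteq> 1" if "i \<noteq> j"
  proof
    assume "q = 1"
    moreover have "cis (2 * pi * real i / n) = q * cis (2 * pi * real j / n)"
      by (simp add: q_def cis_mult right_diff_distrib diff_divide_distrib)
    ultimately have "exp (2 * of_real pi * \<i> * of_nat i / of_nat n) = exp (2 * of_real pi * \<i> * of_nat j / of_nat n)"
      by (simp add: cis_conv_exp mult_ac)
    then show False
      using complex_root_unity_eq[of n i j] assms that n by simp
  qed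
  ultimately show ?thesis
    unfolding * by (auto simp: geometric_sum q_def)
qed

text \<open>Only finitely many values of the function enter the average, so that pointwise convergence alone
  will control Taylor coefficients in the Vitali argument.\<close>

lemma taylor_coeff_roots_of_unity:
  assumes "\<phi> holomorphic_on ball 0 1" and C: "\<And>z. norm z < 1 \<Longrightarrow> norm (\<phi> z) \<le> C"
    and z: "norm z < 1" and "j < n"
  shows "norm ((deriv ^^ j) \<phi> 0 / fact j * z ^ j
           - (\<Sum>l<n. cis (- (2 * pi / n)) ^ (l * j) * \<phi> (cis (2 * pi / n) ^ l * z)) / n)
         \<le> C * norm z ^ n / (1 - norm z)"
proof -
  define a where "a i = (deriv ^^ i) \<phi> 0 / fact i" for i
  define w where "w = cis (2 * pi / n)"
  define v where "v = cis (- (2 * pi / n))"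
  have nw: "norm w = 1" "norm v = 1" by (auto simp: w_def v_def)
  have n: "n > 0" using assms by auto
  \<comment> \<open>Orthogonality extracts \<open>a j\<close> exactly from the Taylor polynomial, so
    the error of the average is an average of these remainders.\<close>
  define R where "R l = \<phi> (w ^ l * z) - (\<Sum>i<n. a i * (w ^ l * z) ^ i)" for l
  have R: "norm (R l) \<le> C * norm z ^ n / (1 - norm z)" for l
    using taylor_remainder_bound[OF assms(1,2), of "w ^ l * z" n] z nw
    by (simp add: R_def a_def norm_mult norm_power)
  have "(\<Sum>l<n. v ^ (l * j) * (\<Sum>i<n. a i * (w ^ l * z) ^ i))
      = (\<Sum>l<n. \<Sum>i<n. a i * z ^ i * (w ^ (l * i) * v ^ (l * j)))"
    by (simp add: sum_distrib_left power_mult_distrib power_mult mult_ac)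
  also have "\<dots> = (\<Sum>i<n. \<Sum>l<n. a i * z ^ i * (w ^ (l * i) * v ^ (l * j)))"
    by (rule sum.swap)
  also have "\<dots> = (\<Sum>i<n. a i * z ^ i * (if i = j then of_nat n else 0))"
    by (intro sum.cong refl) (simp add: sum_distrib_left[symmetric]
        roots_of_unity_orthogonal[OF _ \<open>j < n\<close>] w_def v_def)
  also have "\<dots> = a j * z ^ j * n"
    using \<open>j < n\<close> by (simp add: if_distrib cong: if_cong)
  finally have main: "(\<Sum>l<n. v ^ (l * j) * (\<Sum>i<n. a i * (w ^ l * z) ^ i)) = a j * z ^ j * n" .
  have "(\<Sum>l<n. v ^ (l * j) * R l)
      = (\<Sum>l<n. v ^ (l * j) * \<phi> (w ^ l * z)) - (\<Sum>l<n. v ^ (l * j) * (\<Sum>i<n. a i * (w ^ l * z) ^ i))"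
    by (simp add: R_def right_diff_distrib sum_subtractf)
  then have eq: "a j * z ^ j - (\<Sum>l<n. v ^ (l * j) * \<phi> (w ^ l * z)) / n = - (\<Sum>l<n. v ^ (l * j) * R l) / n"
    using n unfolding main by (simp add: diff_divide_distrib)
  have "norm (\<Sum>l<n. v ^ (l * j) * R l) \<le> (\<Sum>l<n. C * norm z ^ n / (1 - norm z))"
    by (rule sum_norm_le) (use R nw in \<open>simp add: norm_mult norm_power\<close>)
  also have "\<dots> = n * (C * norm z ^ n / (1 - norm z))"
    by simp
  finally have "norm (\<Sum>l<n. v ^ (l * j) * R l) / n \<le> C * norm z ^ n / (1 - norm z)"
    using n by (simp add: field_simps)
  then show ?thesis
    using eq by (simp add: a_def w_def v_def norm_divide)
qed

section \<open>Holomorphic maps of complex inner product spaces\<close>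

lemma hilbert_holomorphic_onD:
  assumes "f hilbert_holomorphic_on S" "open S" "x \<in> S"
  obtains D where "bounded_clinear D" "(f has_derivative D) (at x)"
proof -
  obtain D where "bounded_clinear D" "(f has_derivative D) (at x within S)"
    using assms(1,3) unfolding hilbert_holomorphic_on_def by blast
  then show ?thesis
    using that at_within_open[OF assms(3,2)] by simp
qed

lemma hilbert_holomorphic_on_subset:
  "f hilbert_holomorphic_on S \<Longrightarrow> T \<subseteq> S \<Longrightarrow> f hilbert_holomorphic_on T"
  unfolding hilbert_holomorphic_on_def by (blast intro: has_derivative_subset)

text \<open>Complex linearity of \<open>D\<close> turns the real derivative of a slice into
  multiplication by a complex number; this is the passage to ordinary holomorphic functions.\<close>

lemma has_field_derivative_slice:
  assumes F: "(F has_derivative D) (at (a + z *\<^sub>C v))" and D: "bounded_clinear D"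
  shows "((\<lambda>z. cinner (F (a + z *\<^sub>C v)) u) has_field_derivative cinner (D v) u) (at z)"
proof -
  have "((\<lambda>z. a + z *\<^sub>C v) has_derivative (\<lambda>h. h *\<^sub>C v)) (at z)"
    using has_derivative_add[OF has_derivative_const
        bounded_linear.has_derivative[OF bounded_linear_scaleC_left has_derivative_ident]]
    by simp
  from has_derivative_compose[OF this F]
  have "((\<lambda>z. F (a + z *\<^sub>C v)) has_derivative (\<lambda>h. D (h *\<^sub>C v))) (at z)" .
  from bounded_linear.has_derivative[OF bounded_linear_cinner_left this]
  show ?thesis
    by (simp add: has_field_derivative_def bounded_clinearD[OF D] cinner_scaleC_left mult.commute[of _ "cinner _ _"])
qed

text \<open>Parametrising by a vector \<open>w\<close> of length at most \<open>R\<close> puts every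
  slice on the open unit disc, with the bound \<open>C\<close> unchanged for all unit vectors
  \<open>u\<close>.\<close>

lemma slice_unit_disc:
  assumes F: "F hilbert_holomorphic_on ball a R" and C: "\<And>x. x \<in> ball a R \<Longrightarrow> norm (F x) \<le> C"
    and "R > 0" "norm w \<le> R" and u: "norm u = 1"
  shows "(\<lambda>z. cinner (F (a + z *\<^sub>C w)) u) holomorphic_on ball 0 1"
    and "\<And>z. norm z < 1 \<Longrightarrow> norm (cinner (F (a + z *\<^sub>C w)) u) \<le> C"
proof -
  have mem: "a + z *\<^sub>C w \<in> ball a R" if "norm z < 1" for z
  proof -
    have "norm z * norm w \<le> norm z * R"
      using assms by (intro mult_left_mono) auto
    also have "\<dots> < R" using that \<open>R > 0\<close> by simp
    finally show ?thesis by (simp add: dist_norm)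
  qed
  show "(\<lambda>z. cinner (F (a + z *\<^sub>C w)) u) holomorphic_on ball 0 1"
    unfolding holomorphic_on_open[OF open_ball]
    by (metis has_field_derivative_slice hilbert_holomorphic_onD[OF F open_ball mem] mem_ball_0)
  show "norm (cinner (F (a + z *\<^sub>C w)) u) \<le> C" if "norm z < 1" for z
    using norm_cinner_le[of "F (a + z *\<^sub>C w)" u] C[OF mem[OF that]] u by simp
qed

lemma hilbert_cauchy_estimate:
  assumes F: "F hilbert_holomorphic_on ball a R" and C: "\<And>x. x \<in> ball a R \<Longrightarrow> norm (F x) \<le> C"
    and R: "R > 0" and D: "(F has_derivative D) (at a)" "bounded_clinear D"
  shows "norm (D v) \<le> C / R * norm v"
proof (cases "v = 0")
  case True
  then show ?thesis
    using bounded_clinearD(2)[OF D(2), of 0 0] by simp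
next
  case False
  \<comment> \<open>The direction is rescaled to length \<open>R\<close>, so that the slice uses the
    full ball; its first Taylor coefficient is then \<open>cinner (D w) u\<close>.\<close>
  define c where "c = complex_of_real (R / norm v)"
  define w where "w = c *\<^sub>C v"
  have w: "norm w \<le> R" using False R by (simp add: w_def c_def norm_divide)
  have C0: "0 \<le> C"
    using C[of a] R by (simp add: order_trans[OF norm_ge_zero])
  have "norm (D w) \<le> C"
  proof (rule norm_le_cinnerI)
    fix u :: 'a assume u: "norm u = 1"
    note sl = slice_unit_disc[OF F C R w u]
    have "deriv (\<lambda>z. cinner (F (a + z *\<^sub>C w)) u) 0 = cinner (D w) u"
      by (rule DERIV_imp_deriv, rule has_field_derivative_slice) (use D in auto)
    then show "norm (cinner (D w) u) \<le> C"
      using taylor_coeff_bound[OF sl, of 1] by simp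
  qed (use C0 in auto)
  moreover have "norm (D w) = R / norm v * norm (D v)"
    using R by (simp add: w_def bounded_clinearD[OF D(2)] c_def norm_divide)
  ultimately show ?thesis
    using False R by (simp add: field_simps)
qed

text \<open>This is the remainder after two Taylor terms along the slice through
  \<open>a + v\<close>, at a parameter of modulus \<open>norm v / R\<close>. The factor 2 bounds
  \<open>1 / (1 - norm z)\<close> for \<open>norm z \<le> 1 / 2\<close>.\<close>

lemma hilbert_quadratic_estimate:
  assumes F: "F hilbert_holomorphic_on ball a R" and C: "\<And>x. x \<in> ball a R \<Longrightarrow> norm (F x) \<le> C"
    and R: "R > 0" and D: "(F has_derivative D) (at a)" "bounded_clinear D"
    and v: "norm v \<le> R / 2"
  shows "norm (F (a + v) - F a - D v) \<le> 2 * C / R\<^sup>2 * (norm v)\<^sup>2"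
proof (cases "v = 0")
  case True
  then show ?thesis
    using bounded_clinearD(2)[OF D(2), of 0 0] by simp
next
  case False
  define c where "c = complex_of_real (R / norm v)"
  define w where "w = c *\<^sub>C v"
  define z where "z = complex_of_real (norm v / R)"
  have w: "norm w \<le> R" using False R by (simp add: w_def c_def norm_divide)
  have v': "v = z *\<^sub>C w"
    using False R by (simp add: w_def z_def c_def scaleC_scaleC scaleC_one)
  have z: "norm z = norm v / R" using R by (simp add: z_def norm_divide)
  have z2: "norm z \<le> 1 / 2" using v R by (simp add: z field_simps)
  have C0: "0 \<le> C"
    using C[of a] R by (simp add: order_trans[OF norm_ge_zero])
  show ?thesis
  proof (rule norm_le_cinnerI)
    fix u :: 'a assume u: "norm u = 1"
    note sl = slice_unit_disc[OF F C R w u]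
    have "deriv (\<lambda>z. cinner (F (a + z *\<^sub>C w)) u) 0 = cinner (D w) u"
      by (rule DERIV_imp_deriv, rule has_field_derivative_slice) (use D in auto)
    then have "norm (cinner (F (a + z *\<^sub>C w)) u - (cinner (F a) u + cinner (D w) u * z))
        \<le> C * (norm z)\<^sup>2 / (1 - norm z)"
      using taylor_remainder_bound[OF sl, of z 2] z2 by (simp add: numeral_2_eq_2)
    moreover have "cinner (F (a + v) - F a - D v) u
        = cinner (F (a + z *\<^sub>C w)) u - (cinner (F a) u + cinner (D w) u * z)"
      unfolding v' bounded_clinearD(2)[OF D(2)] cinner_diff_left cinner_scaleC_left by simp
    ultimately have "norm (cinner (F (a + v) - F a - D v) u) \<le> C * (norm z)\<^sup>2 / (1 - norm z)"
      by simp
    also have "\<dots> \<le> C * (norm z)\<^sup>2 / (1 / 2)"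
      using z2 C0 by (intro divide_left_mono) auto
    also have "\<dots> = 2 * C / R\<^sup>2 * (norm v)\<^sup>2"
      by (simp add: z power_divide)
    finally show "norm (cinner (F (a + v) - F a - D v) u) \<le> 2 * C / R\<^sup>2 * (norm v)\<^sup>2" .
  qed (use C0 in auto)
qed

text \<open>The coefficient of order zero in the root-of-unity formula, lifted to vectors: a finite
  mean value property whose error decays exponentially in the number of sample points.\<close>

lemma hilbert_mean_value_roots_of_unity:
  assumes F: "F hilbert_holomorphic_on ball a R" and C: "\<And>x. x \<in> ball a R \<Longrightarrow> norm (F x) \<le> C"
    and R: "R > 0" and w: "norm w \<le> R" and z: "norm z < 1" and n: "0 < n"
  shows "norm (F a - (\<Sum>l<n. F (a + (cis (2 * pi / n) ^ l * z) *\<^sub>C w)) /\<^sub>R n)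
         \<le> C * norm z ^ n / (1 - norm z)"
proof (rule norm_le_cinnerI)
  fix u :: 'a assume u: "norm u = 1"
  note sl = slice_unit_disc[OF F C R w u]
  show "norm (cinner (F a - (\<Sum>l<n. F (a + (cis (2 * pi / n) ^ l * z) *\<^sub>C w)) /\<^sub>R n) u)
         \<le> C * norm z ^ n / (1 - norm z)"
    using taylor_coeff_roots_of_unity[OF sl z n]
    by (simp add: cinner_diff_left cinner_sum_left scaleR_scaleC cinner_scaleC_left
        divide_inverse mult.commute)
next
  have "0 \<le> C"
    using C[of a] R by (simp add: order_trans[OF norm_ge_zero])
  then show "0 \<le> C * norm z ^ n / (1 - norm z)" using z by simp
qed

section \<open>Convergence of bounded families of holomorphic maps\<close>

lemma eventually_geometric_small:
  fixes t :: real
  assumes "0 \<le> t" "t < 1" "\<epsilon> > 0"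
  shows "eventually (\<lambda>n. C * t ^ n / (1 - t) < \<epsilon>) sequentially"
proof -
  have "(\<lambda>n. C * t ^ n / (1 - t)) \<longlonglongrightarrow> C * 0 / (1 - t)"
    by (intro tendsto_intros LIMSEQ_realpow_zero) (use assms in auto)
  then show ?thesis
    using order_tendstoD(2) assms(3) by (metis mult_zero_right div_0)
qed

text \<open>Along the slice through \<open>x\<close>, each Taylor coefficient is close to an average
  over finitely many points of the small ball, hence tends to 0; the tail of the series is uniformly
  small by boundedness. Both bounds are uniform in the functional \<open>u\<close>, which gives
  convergence in norm. An arbitrary filter is allowed so that Cauchy differences, indexed by pairs,
  can be treated too.\<close>

lemma vitali_ball:
  fixes G :: "'i \<Rightarrow> 'a::complex_inner \<Rightarrow> 'a"
  assumes G: "\<And>i. G i hilbert_holomorphic_on ball a R"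
    and C: "\<And>i x. x \<in> ball a R \<Longrightarrow> norm (G i x) \<le> C"
    and s: "0 < s" "s \<le> R" and lim: "\<And>x. x \<in> ball a s \<Longrightarrow> ((\<lambda>i. G i x) \<longlongrightarrow> 0) \<F>"
    and x: "x \<in> ball a R"
  shows "((\<lambda>i. G i x) \<longlongrightarrow> 0) \<F>"
proof (cases "x = a")
  case True
  then show ?thesis using lim s by auto
next
  case False
  define d where "d = norm (x - a)"
  have d: "0 < d" "d < R" using False x by (auto simp: d_def dist_norm norm_minus_commute)
  then have R: "R > 0" by simp
  define w where "w = complex_of_real (R / d) *\<^sub>C (x - a)"
  define z where "z = complex_of_real (d / R)"
  have w: "norm w \<le> R" using d by (simp add: w_def d_def[symmetric] norm_divide)
  have xw: "x = a + z *\<^sub>C w"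
    using d by (simp add: w_def z_def scaleC_scaleC scaleC_one)
  have z: "norm z < 1" using d by (simp add: z_def norm_divide)
  define \<phi> where "\<phi> i u z = cinner (G i (a + z *\<^sub>C w)) u" for i u z
  define \<alpha> where "\<alpha> i u j = (deriv ^^ j) (\<phi> i u) 0 / fact j" for i u j
  have sl: "\<phi> i u holomorphic_on ball 0 1" "norm z < 1 \<Longrightarrow> norm (\<phi> i u z) \<le> C" if "norm u = 1" for i u z
    unfolding \<phi>_def using slice_unit_disc[OF G C R w that] by blast+
  have \<phi>_le: "norm (\<phi> i u z) \<le> norm (G i (a + z *\<^sub>C w))" if "norm u = 1" for i u z
    unfolding \<phi>_def using norm_cinner_le[of "G i (a + z *\<^sub>C w)" u] that by simp
  have ev: "eventually (\<lambda>i. \<forall>u. norm u = 1 \<longrightarrow> norm (\<alpha> i u j) \<le> \<eta>) \<F>" if \<eta>: "\<eta> > 0" for j \<eta>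
  proof -
    \<comment> \<open>With this radius all samples
      \<open>a + (\<omega> ^ l * of_real t) *\<^sub>C w\<close> are within \<open>s / 2\<close> of
      the centre.\<close>
    define t where "t = s / (2 * R)"
    have t: "0 < t" "t < 1" using s R by (auto simp: t_def)
    have "eventually (\<lambda>n. C * t ^ n / (1 - t) < \<eta> * t ^ j / 2) sequentially"
      by (rule eventually_geometric_small) (use t \<eta> in auto)
    from eventually_conj[OF this eventually_gt_at_top[of j]]
    obtain n where n: "C * t ^ n / (1 - t) < \<eta> * t ^ j / 2" "j < n"
      using eventually_happens'[OF sequentially_bot] by blast
    define \<omega> where "\<omega> = cis (2 * pi / n)"
    have "eventually (\<lambda>i. norm (G i (a + (\<omega> ^ l * of_real t) *\<^sub>C w)) < \<eta> * t ^ j / 2) \<F>" for l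
    proof -
      have "t * norm w \<le> t * R" using t w by (intro mult_left_mono) auto
      also have "\<dots> < s" using s R by (simp add: t_def)
      finally have "a + (\<omega> ^ l * of_real t) *\<^sub>C w \<in> ball a s"
        using t by (simp add: dist_norm \<omega>_def norm_mult norm_power)
      from lim[OF this] show ?thesis
        using t \<eta> by (auto dest!: tendstoD[of _ _ _ "\<eta> * t ^ j / 2"])
    qed
    then have "eventually (\<lambda>i. \<forall>l\<in>{..<n}. norm (G i (a + (\<omega> ^ l * of_real t) *\<^sub>C w)) < \<eta> * t ^ j / 2) \<F>"
      by (intro eventually_ball_finite) auto
    then show ?thesis
    proof eventually_elim
      case (elim i)
      show ?case
      proof (intro allI impI)
        fix u :: 'a assume u: "norm u = 1"
        define A where "A = (\<Sum>l<n. cis (- (2 * pi / n)) ^ (l * j) * \<phi> i u (\<omega> ^ l * of_real t)) / n"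
        have "norm (\<Sum>l<n. cis (- (2 * pi / n)) ^ (l * j) * \<phi> i u (\<omega> ^ l * of_real t))
            \<le> (\<Sum>l<n. \<eta> * t ^ j / 2)"
        proof (rule sum_norm_le)
          fix l assume "l \<in> {..<n}"
          then have "norm (\<phi> i u (\<omega> ^ l * of_real t)) \<le> \<eta> * t ^ j / 2"
            using elim[rule_format, of l] \<phi>_le[OF u, of i "\<omega> ^ l * of_real t"] by linarith
          then show "norm (cis (- (2 * pi / n)) ^ (l * j) * \<phi> i u (\<omega> ^ l * of_real t)) \<le> \<eta> * t ^ j / 2"
            by (simp add: norm_mult norm_power)
        qed
        then have A: "norm A \<le> \<eta> * t ^ j / 2"
          using n(2) by (simp add: A_def norm_divide field_simps)
        have "norm (\<alpha> i u j * of_real t ^ j - A) \<le> C * t ^ n / (1 - t)"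
          using taylor_coeff_roots_of_unity[OF sl(1)[OF u] sl(2)[OF u] _ n(2), of "of_real t" i] t
          by (simp add: \<alpha>_def A_def \<omega>_def)
        then have "norm (\<alpha> i u j * of_real t ^ j) \<le> \<eta> * t ^ j"
          using A n(1) norm_triangle_sub[of "\<alpha> i u j * of_real t ^ j" A] by linarith
        then show "norm (\<alpha> i u j) \<le> \<eta>"
          using t by (simp add: norm_mult norm_power)
      qed
    qed
  qed
  show ?thesis
  proof (rule tendstoI)
    fix \<epsilon> :: real assume \<epsilon>: "\<epsilon> > 0"
    have "eventually (\<lambda>n. C * norm z ^ n / (1 - norm z) < \<epsilon> / 3) sequentially"
      by (rule eventually_geometric_small) (use z \<epsilon> in auto)
    then obtain n where n: "C * norm z ^ n / (1 - norm z) < \<epsilon> / 3"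
      using eventually_happens'[OF sequentially_bot] by blast
    \<comment> \<open>The \<open>n\<close> coefficients together then contribute at most a third of
      \<open>\<epsilon>\<close>; adding 1 keeps the quotient meaningful when
      \<open>n = 0\<close>.\<close>
    define \<eta> where "\<eta> = \<epsilon> / (3 * (n + 1))"
    have "eventually (\<lambda>i. \<forall>j\<in>{..<n}. \<forall>u. norm u = 1 \<longrightarrow> norm (\<alpha> i u j) \<le> \<eta>) \<F>"
      using ev[of \<eta>] \<epsilon> by (intro eventually_ball_finite) (auto simp: \<eta>_def)
    then show "eventually (\<lambda>i. dist (G i x) 0 < \<epsilon>) \<F>"
    proof eventually_elim
      case (elim i)
      have "norm (G i x) \<le> 2 * \<epsilon> / 3"
      proof (rule norm_le_cinnerI)
        fix u :: 'a assume u: "norm u = 1"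
        have "norm (\<Sum>j<n. \<alpha> i u j * z ^ j) \<le> (\<Sum>j<n. \<eta>)"
        proof (rule sum_norm_le)
          fix j assume j: "j \<in> {..<n}"
          have "norm (\<alpha> i u j) * norm z ^ j \<le> \<eta> * 1"
            using elim j u z by (intro mult_mono) (auto simp: power_le_one \<eta>_def \<epsilon> less_imp_le)
          then show "norm (\<alpha> i u j * z ^ j) \<le> \<eta>" by (simp add: norm_mult norm_power)
        qed
        also have "\<dots> \<le> \<epsilon> / 3" using \<epsilon> by (simp add: \<eta>_def field_simps)
        finally have 1: "norm (\<Sum>j<n. \<alpha> i u j * z ^ j) \<le> \<epsilon> / 3" .
        have "norm (\<phi> i u z - (\<Sum>j<n. \<alpha> i u j * z ^ j)) \<le> C * norm z ^ n / (1 - norm z)"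
          unfolding \<alpha>_def by (rule taylor_remainder_bound[OF sl(1)[OF u] sl(2)[OF u] z])
        then have "norm (\<phi> i u z) \<le> 2 * \<epsilon> / 3"
          using 1 n norm_triangle_sub[of "\<phi> i u z" "\<Sum>j<n. \<alpha> i u j * z ^ j"] by linarith
        then show "norm (cinner (G i x) u) \<le> 2 * \<epsilon> / 3"
          by (simp add: \<phi>_def xw[symmetric])
      qed (use \<epsilon> in auto)
      then show ?case using \<epsilon> by simp
    qed
  qed
qed

lemma connected_open_exhaust:
  assumes "connected S" "A \<subseteq> S" "open A" "A \<noteq> {}" "open (S - A)"
  shows "A = S"
proof -
  have "A \<inter> S = {} \<or> (S - A) \<inter> S = {}"
    by (rule connectedD[OF assms(1,3,5)]) auto
  then show ?thesis
    using assms(2,4) by blast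
qed

text \<open>The points near which convergence holds form an open set, and the result on balls shows
  that its complement in \<open>S\<close> is open as well.\<close>

lemma vitali_connected:
  fixes G :: "'i \<Rightarrow> 'a::complex_inner \<Rightarrow> 'a"
  assumes S: "open S" "connected S" and G: "\<And>i. G i hilbert_holomorphic_on S"
    and C: "\<And>i x. x \<in> S \<Longrightarrow> norm (G i x) \<le> C"
    and s: "0 < s" "ball p s \<subseteq> S" and lim: "\<And>x. x \<in> ball p s \<Longrightarrow> ((\<lambda>i. G i x) \<longlongrightarrow> 0) \<F>"
    and x: "x \<in> S"
  shows "((\<lambda>i. G i x) \<longlongrightarrow> 0) \<F>"
proof -
  define A where "A = {x\<in>S. \<exists>r>0. ball x r \<subseteq> S \<and> (\<forall>y\<in>ball x r. ((\<lambda>i. G i y) \<longlongrightarrow> 0) \<F>)}"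
  have inA: "x \<in> A" if xy: "x \<in> ball y r" and y: "ball y r \<subseteq> S" "\<forall>y\<in>ball y r. ((\<lambda>i. G i y) \<longlongrightarrow> 0) \<F>" for x y r
  proof -
    obtain e where e: "e > 0" "ball x e \<subseteq> ball y r"
      by (rule openE[OF open_ball xy])
    have "x \<in> S" using xy y by blast
    moreover have "ball x e \<subseteq> S \<and> (\<forall>y\<in>ball x e. ((\<lambda>i. G i y) \<longlongrightarrow> 0) \<F>)"
      using e(2) y by blast
    ultimately show ?thesis
      unfolding A_def using e(1) by blast
  qed
  have "A = S"
  proof (rule connected_open_exhaust[OF S(2)])
    show "A \<noteq> {}"
      using inA[of p p s] s lim by auto
    show "open A"
      unfolding open_contains_ball
    proof
      fix y assume "y \<in> A"
      then obtain r where "r > 0" "ball y r \<subseteq> S" "\<forall>x\<in>ball y r. ((\<lambda>i. G i x) \<longlongrightarrow> 0) \<F>"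
        by (auto simp: A_def)
      then show "\<exists>e>0. ball y e \<subseteq> A" using inA by blast
    qed
    show "open (S - A)"
      unfolding open_contains_ball
    proof
      fix y assume y: "y \<in> S - A"
      then obtain R where R: "R > 0" "ball y R \<subseteq> S"
        using S(1) open_contains_ball by blast
      \<comment> \<open>Half the radius is chosen so that the ball of the same radius about
        \<open>b\<close> stays in \<open>S\<close> and contains \<open>y\<close>: convergence near
        \<open>b\<close> would spread to a neighbourhood of \<open>y\<close>.\<close>
      have "b \<notin> A" if b: "b \<in> ball y (R / 2)" for b
      proof
        assume "b \<in> A"
        then obtain r where r: "r > 0" "\<forall>x\<in>ball b r. ((\<lambda>i. G i x) \<longlongrightarrow> 0) \<F>"
          by (auto simp: A_def)
        have sub: "ball b (R / 2) \<subseteq> S"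
        proof
          fix x assume "x \<in> ball b (R / 2)"
          then have "dist y x < R"
            using b dist_triangle[of y x b] by simp
          then show "x \<in> S" using R by auto
        qed
        have "((\<lambda>i. G i x) \<longlongrightarrow> 0) \<F>" if "x \<in> ball b (R / 2)" for x
          by (rule vitali_ball[where a = b and R = "R / 2" and s = "min r (R / 2)" and C = C])
            (use that sub r R C in \<open>auto intro: hilbert_holomorphic_on_subset[OF G sub]\<close>)
        then have "y \<in> A"
          using inA[of y b "R / 2"] sub b by (simp add: dist_commute)
        then show False using y by simp
      qed
      then show "\<exists>e>0. ball y e \<subseteq> S - A"
        using R by (intro exI[of _ "R / 2"]) auto
    qed
  qed (auto simp: A_def)
  then have "x \<in> A" using x by simp
  then obtain r where "r > 0" "\<forall>y\<in>ball x r. ((\<lambda>i. G i y) \<longlongrightarrow> 0) \<F>"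
    unfolding A_def by blast
  then show ?thesis
    by (metis centre_in_ball)
qed

lemma hilbert_holomorphic_on_limit:
  fixes F :: "nat \<Rightarrow> 'a::chilbert_space \<Rightarrow> 'a"
  assumes S: "open S" and F: "\<And>i. F i hilbert_holomorphic_on S"
    and C: "\<And>i x. x \<in> S \<Longrightarrow> norm (F i x) \<le> C"
    and lim: "\<And>x. x \<in> S \<Longrightarrow> (\<lambda>i. F i x) \<longlonglongrightarrow> h x"
  shows "h hilbert_holomorphic_on S"
  unfolding hilbert_holomorphic_on_def
proof
  fix a assume a: "a \<in> S"
  then obtain R where R: "R > 0" "ball a R \<subseteq> S"
    using S open_contains_ball by blast
  have C0: "0 \<le> C" using order_trans[OF norm_ge_zero C[OF a]] .
  define K where "K = 2 * C / R\<^sup>2"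
  have K: "K \<ge> 0" using C0 by (simp add: K_def)
  have "\<exists>D. bounded_clinear D \<and> (F i has_derivative D) (at a)" for i
    by (rule hilbert_holomorphic_onD[OF F S a]) blast
  then obtain D where D: "\<And>i. bounded_clinear (D i)" "\<And>i. (F i has_derivative D i) (at a)"
    by metis
  have FR: "F i hilbert_holomorphic_on ball a R" for i
    using hilbert_holomorphic_on_subset[OF F R(2)] .
  have CR: "norm (F i x) \<le> C" if "x \<in> ball a R" for i x
    using C R that by blast
  have quad: "norm (F i (a + v) - F i a - D i v) \<le> K * (norm v)\<^sup>2" if "norm v \<le> R / 2" for i v
    unfolding K_def by (rule hilbert_quadratic_estimate[OF FR CR R(1) D(2) D(1) that])
  have bd: "norm (D i v) \<le> C / R * norm v" for i v
    by (rule hilbert_cauchy_estimate[OF FR CR R(1) D(2) D(1)])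
  have "convergent (\<lambda>i. D i v)" for v
  proof (rule Cauchy_convergent, rule metric_CauchyI)
    fix e :: real assume e: "e > 0"
    define P where "P = K * (norm v)\<^sup>2 + 1"
    \<comment> \<open>The first bound keeps \<open>t\<close> times \<open>v\<close> within the range
      of the quadratic estimate; the second makes the difference quotient accurate to
      \<open>e / 4\<close> for every \<open>i\<close>.\<close>
    define t where "t = min (R / (2 * (norm v + 1))) (e / (4 * P))"
    have pos: "P > 0"
      using K by (simp add: P_def add_nonneg_pos)
    have t: "t > 0" using R e pos by (simp add: t_def add_nonneg_pos)
    have "t * norm v \<le> R / (2 * (norm v + 1)) * (norm v + 1)"
      using R by (intro mult_mono) (auto simp: t_def)
    also have "\<dots> = R / 2"
    proof -
      have "norm v + 1 \<noteq> 0" using norm_ge_zero[of v] by linarith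
      then show ?thesis by (metis nonzero_mult_divide_mult_cancel_right times_divide_eq_left)
    qed
    finally have t1: "norm (of_real t *\<^sub>C v) \<le> R / 2"
      using t by simp
    have "t * (K * (norm v)\<^sup>2) \<le> e / (4 * P) * P"
      using K e pos by (intro mult_mono) (auto simp: t_def P_def)
    then have t2: "t * (K * (norm v)\<^sup>2) \<le> e / 4"
      using pos by simp
    define \<Delta> where "\<Delta> i = (F i (a + of_real t *\<^sub>C v) - F i a) /\<^sub>R t" for i
    have \<Delta>: "norm (\<Delta> i - D i v) \<le> e / 4" for i
    proof -
      have "\<Delta> i - D i v = (F i (a + of_real t *\<^sub>C v) - F i a - D i (of_real t *\<^sub>C v)) /\<^sub>R t"
        using t by (simp add: \<Delta>_def bounded_clinearD[OF D(1)] scaleR_scaleC scaleC_diff_right scaleC_scaleC scaleC_one)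
      then have "norm (\<Delta> i - D i v) = norm (F i (a + of_real t *\<^sub>C v) - F i a - D i (of_real t *\<^sub>C v)) / t"
        using t by (simp add: divide_inverse mult.commute)
      also have "\<dots> \<le> K * (norm (of_real t *\<^sub>C v))\<^sup>2 / t"
        using quad[OF t1] t by (intro divide_right_mono) auto
      also have "\<dots> = t * (K * (norm v)\<^sup>2)"
        using t by (simp add: power_mult_distrib power2_eq_square)
      finally show ?thesis using t2 by simp
    qed
    have "a + of_real t *\<^sub>C v \<in> S"
      using t1 R by (intro subsetD[OF R(2)]) (auto simp: dist_norm)
    then have "\<Delta> \<longlonglongrightarrow> (h (a + of_real t *\<^sub>C v) - h a) /\<^sub>R t"
      unfolding \<Delta>_def by (intro tendsto_intros lim a)
    then have "convergent \<Delta>" by (rule convergentI)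
    then have "Cauchy \<Delta>" by (rule convergent_Cauchy)
    from metric_CauchyD[OF this, of "e / 4"] e obtain N where N: "\<And>m n. m \<ge> N \<Longrightarrow> n \<ge> N \<Longrightarrow> dist (\<Delta> m) (\<Delta> n) < e / 4"
      by auto
    have "dist (D m v) (D n v) < e" if "m \<ge> N" "n \<ge> N" for m n
    proof -
      have "dist (D m v) (D n v) \<le> dist (D m v) (\<Delta> m) + dist (\<Delta> m) (\<Delta> n) + dist (\<Delta> n) (D n v)"
        using dist_triangle[of "D m v" "D n v" "\<Delta> m"] dist_triangle[of "\<Delta> m" "D n v" "\<Delta> n"]
        by linarith
      then show ?thesis
        using N[OF that] \<Delta>[of m] \<Delta>[of n] e by (simp add: dist_norm norm_minus_commute)
    qed
    then show "\<exists>M. \<forall>m\<ge>M. \<forall>n\<ge>M. dist (D m v) (D n v) < e" by blast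
  qed
  then obtain E where E: "\<And>v. (\<lambda>i. D i v) \<longlonglongrightarrow> E v"
    unfolding convergent_def by metis
  note bl = bounded_clinearD(1)[OF D(1)]
  have E_scaleC: "E (c *\<^sub>C v) = c *\<^sub>C E v" for c v
  proof (rule LIMSEQ_unique[OF E])
    show "(\<lambda>i. D i (c *\<^sub>C v)) \<longlonglongrightarrow> c *\<^sub>C E v"
      unfolding bounded_clinearD[OF D(1)]
      by (rule bounded_linear.tendsto[OF bounded_linear_scaleC_right E])
  qed
  have E_add: "E (v + w) = E v + E w" for v w
  proof (rule LIMSEQ_unique[OF E])
    show "(\<lambda>i. D i (v + w)) \<longlonglongrightarrow> E v + E w"
      unfolding linear_add[OF bounded_linear.linear[OF bl]] by (intro tendsto_add E)
  qed
  have E_bd: "norm (E v) \<le> C / R * norm v" for v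
    by (rule LIMSEQ_le_const2[OF tendsto_norm[OF E]]) (use bd in blast)
  have blE: "bounded_linear E"
    by (rule bounded_linear_intro[of _ "C / R"])
      (use E_bd in \<open>auto simp: E_add E_scaleC scaleR_scaleC mult.commute\<close>)
  then have "bounded_clinear E"
    by (simp add: bounded_clinear_def E_scaleC)
  moreover have "(h has_derivative E) (at a)"
    unfolding has_derivative_at_alt
  proof (intro conjI blE allI impI)
    fix e :: real assume e: "e > 0"
    have quadE: "norm (h (a + v) - h a - E v) \<le> K * (norm v)\<^sup>2" if v: "norm v \<le> R / 2" for v
    proof (rule LIMSEQ_le_const2)
      have "a + v \<in> S" using v R by (intro subsetD[OF R(2)]) (auto simp: dist_norm)
      then show "(\<lambda>i. norm (F i (a + v) - F i a - D i v)) \<longlonglongrightarrow> norm (h (a + v) - h a - E v)"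
        by (intro tendsto_intros lim E a)
    qed (use quad[OF v] in blast)
    define d where "d = min (R / 2) (e / (K + 1))"
    have "d > 0" using R e K by (simp add: d_def)
    moreover have "norm (h y - h a - E (y - a)) \<le> e * norm (y - a)" if y: "norm (y - a) < d" for y
    proof -
      have "K * norm (y - a) \<le> (K + 1) * (e / (K + 1))"
        using y K e by (intro mult_mono) (auto simp: d_def)
      then have "K * norm (y - a) \<le> e" using K by simp
      then have "K * (norm (y - a))\<^sup>2 \<le> e * norm (y - a)"
        using mult_right_mono[of _ _ "norm (y - a)"] by (fastforce simp: power2_eq_square)
      then show ?thesis
        using quadE[of "y - a"] y by (simp add: d_def)
    qed
    ultimately show "\<exists>d>0. \<forall>y. norm (y - a) < d \<longrightarrow> norm (h y - h a - E (y - a)) \<le> e * norm (y - a)"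
      by blast
  qed
  ultimately show "\<exists>D. bounded_clinear D \<and> (h has_derivative D) (at a within S)"
    using has_derivative_at_withinI by blast
qed

section \<open>Maximum principle for values in a convex set\<close>

lemma convex_open_closure_combination:
  fixes S :: "'a::real_normed_vector set"
  assumes S: "open S" "convex S" and b: "b \<in> S" and c: "c \<in> closure S" and t: "0 < t" "t \<le> 1"
  shows "t *\<^sub>R b + (1 - t) *\<^sub>R c \<in> S"
proof -
  obtain e where e: "e > 0" "ball b e \<subseteq> S"
    by (rule openE[OF S(1) b])
  obtain c' where c': "c' \<in> S" "dist c' c < e * t"
    using c e t unfolding closure_approachable by (meson mult_pos_pos)
  \<comment> \<open>Replacing \<open>c\<close> by a nearby point \<open>c'\<close> of
    \<open>S\<close> is compensated at \<open>b\<close>, where openness leaves room; the weight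
    ratio makes the combination unchanged.\<close>
  define b' where "b' = b + ((1 - t) / t) *\<^sub>R (c - c')"
  have "norm (b' - b) \<le> 1 / t * norm (c - c')"
    using t by (auto simp: b'_def mult_left_le_one_le intro!: divide_right_mono)
  also have "\<dots> < e"
    using c' t by (simp add: dist_norm norm_minus_commute field_simps)
  finally have "b' \<in> ball b e" by (simp add: dist_norm norm_minus_commute)
  then have "b' \<in> S" using e by blast
  then have "t *\<^sub>R b' + (1 - t) *\<^sub>R c' \<in> S"
    using convexD[OF S(2) _ c'(1), of b' t "1 - t"] t by simp
  moreover have "t *\<^sub>R b' + (1 - t) *\<^sub>R c' = t *\<^sub>R b + (1 - t) *\<^sub>R c"
    using t by (simp add: b'_def scaleR_add_right scaleR_diff_right)
  ultimately show ?thesis by simp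
qed

text \<open>A maximum principle: a point value is, up to an exponentially small error, an average
  over roots of unity in which one value in the open convex set has weight \<open>1 / n\<close>.\<close>

lemma holomorphic_into_closure_convex:
  assumes h: "h hilbert_holomorphic_on ball x R" and C: "\<And>y. y \<in> ball x R \<Longrightarrow> norm (h y) \<le> C"
    and S: "open S" "convex S" and cl: "h ` ball x R \<subseteq> closure S"
    and y: "y \<in> ball x R" "h y \<in> S"
  shows "h x \<in> S"
proof (cases "y = x")
  case False
  define d where "d = norm (y - x)"
  have d: "0 < d" "d < R" using False y by (auto simp: d_def dist_norm norm_minus_commute)
  then have R: "R > 0" by simp
  define w where "w = complex_of_real (R / d) *\<^sub>C (y - x)"
  define z where "z = complex_of_real (d / R)"
  have w: "norm w \<le> R" using d by (simp add: w_def d_def[symmetric] norm_divide)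
  have yw: "y = x + z *\<^sub>C w"
    using d by (simp add: w_def z_def scaleC_scaleC scaleC_one)
  have z: "norm z < 1" using d by (simp add: z_def norm_divide)
  obtain e where e: "e > 0" "ball (h y) e \<subseteq> S"
    by (rule openE[OF S(1) y(2)])
  \<comment> \<open>The mean value error is multiplied by \<open>n\<close> because it will be
    absorbed by a single value of weight \<open>1 / n\<close>; exponential decay still wins.\<close>
  have "(\<lambda>n. real n * norm z ^ n * (C / (1 - norm z))) \<longlonglongrightarrow> 0 * (C / (1 - norm z))"
    by (intro tendsto_intros powser_times_n_limit_0) (use z in auto)
  then have "eventually (\<lambda>n. real n * norm z ^ n * (C / (1 - norm z)) < e) sequentially"
    using order_tendstoD(2) e(1) by (metis mult_zero_left)
  from eventually_conj[OF this eventually_ge_at_top[of 2]]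
  obtain n where n: "real n * norm z ^ n * (C / (1 - norm z)) < e" "2 \<le> n"
    using eventually_happens'[OF sequentially_bot] by blast
  define P where "P l = x + (cis (2 * pi / n) ^ l * z) *\<^sub>C w" for l
  have P: "P l \<in> ball x R" for l
  proof -
    have "norm z * norm w \<le> norm z * R" using w by (intro mult_left_mono) auto
    also have "\<dots> < R" using z R by simp
    finally show ?thesis by (simp add: P_def dist_norm norm_mult norm_power)
  qed
  \<comment> \<open>The sample with index 0 is \<open>y\<close>, whose value is known to be
    interior; it is the one that takes up the error.\<close>
  have P0: "P 0 = y" by (simp add: P_def yw)
  define err where "err = h x - (\<Sum>l<n. h (P l)) /\<^sub>R n"
  have "norm err \<le> C * norm z ^ n / (1 - norm z)"
    unfolding err_def P_def
    by (rule hilbert_mean_value_roots_of_unity[OF h C R w z]) (use n in auto)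
  then have "norm (real n *\<^sub>R err) \<le> real n * (C * norm z ^ n / (1 - norm z))"
    unfolding norm_scaleR by (simp only: abs_of_nat) (rule mult_left_mono, auto)
  also have "\<dots> < e" using n(1) by (simp add: mult_ac)
  finally have "h y + real n *\<^sub>R err \<in> ball (h y) e" by (simp add: dist_norm)
  then have b: "h y + real n *\<^sub>R err \<in> S" using e by blast
  \<comment> \<open>The mean of the other \<open>n - 1\<close> values, hence the requirement
    \<open>2 \<le> n\<close>; convexity of the closure puts it there.\<close>
  define c where "c = (\<Sum>l\<in>{1..<n}. (1 / (real n - 1)) *\<^sub>R h (P l))"
  have c: "c \<in> closure S"
    unfolding c_def
    by (rule convex_sum) (use n P cl S in \<open>auto simp: convex_closure of_nat_diff image_subset_iff\<close>)
  have sum: "(\<Sum>l<n. h (P l)) = h y + (real n - 1) *\<^sub>R c"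
  proof -
    have "(\<Sum>l<n. h (P l)) = h (P 0) + (\<Sum>l\<in>{1..<n}. h (P l))"
      using n by (simp add: lessThan_atLeast0 sum.atLeast_Suc_lessThan)
    then show ?thesis
      using n by (simp add: c_def P0 scaleR_sum_right[symmetric])
  qed
  have "(1 / real n) *\<^sub>R (h y + real n *\<^sub>R err) + (1 - 1 / real n) *\<^sub>R c = h x"
  proof -
    have "h x = err + (h y + (real n - 1) *\<^sub>R c) /\<^sub>R n"
      by (simp add: err_def sum)
    moreover have "(1 - 1 / real n) = inverse (real n) * (real n - 1)"
      using n by (simp add: field_simps)
    ultimately show ?thesis
      using n by (simp add: scaleR_add_right divide_inverse)
  qed
  with convex_open_closure_combination[OF S b c, of "1 / real n"] n show ?thesis
    by simp
qed (use y in auto)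

section \<open>Stability of holomorphy and the differential\<close>

lemma bounded_clinear_compose: "bounded_clinear A \<Longrightarrow> bounded_clinear B \<Longrightarrow> bounded_clinear (\<lambda>x. A (B x))"
  by (simp add: bounded_clinear_def bounded_linear_compose)

lemma bounded_clinear_diff:
  "bounded_clinear A \<Longrightarrow> bounded_clinear B \<Longrightarrow> bounded_clinear (\<lambda>x. A x - B x)"
  by (simp add: bounded_clinear_def bounded_linear_sub scaleC_diff_right)

lemma bounded_clinear_ident: "bounded_clinear (\<lambda>x. x)"
  by (simp add: bounded_clinear_def bounded_linear_ident)

lemma bounded_clinear_zero: "bounded_clinear (\<lambda>x. 0)"
  by (simp add: bounded_clinear_def)

lemma hilbert_holomorphic_onI:
  assumes "\<And>x. x \<in> S \<Longrightarrow> \<exists>D. bounded_clinear D \<and> (f has_derivative D) (at x)"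
  shows "f hilbert_holomorphic_on S"
  unfolding hilbert_holomorphic_on_def using assms by (blast intro: has_derivative_at_withinI)

lemma hilbert_holomorphic_on_cong:
  assumes "f hilbert_holomorphic_on S" "\<And>x. x \<in> S \<Longrightarrow> g x = f x"
  shows "g hilbert_holomorphic_on S"
  unfolding hilbert_holomorphic_on_def
proof
  fix x assume x: "x \<in> S"
  then obtain D where D: "bounded_clinear D" "(f has_derivative D) (at x within S)"
    using assms(1) unfolding hilbert_holomorphic_on_def by blast
  have "(g has_derivative D) (at x within S)"
    by (rule has_derivative_transform[OF x assms(2) D(2)])
  with D(1) show "\<exists>D. bounded_clinear D \<and> (g has_derivative D) (at x within S)" by blast
qed

lemma hilbert_holomorphic_on_compose:
  assumes f: "f hilbert_holomorphic_on S" and g: "g hilbert_holomorphic_on U"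
    and S: "open S" "open U" "f ` S \<subseteq> U"
  shows "(\<lambda>x. g (f x)) hilbert_holomorphic_on S"
proof (rule hilbert_holomorphic_onI)
  fix x assume x: "x \<in> S"
  obtain A where A: "bounded_clinear A" "(f has_derivative A) (at x)"
    by (rule hilbert_holomorphic_onD[OF f S(1) x])
  have "f x \<in> U" using x S by blast
  from hilbert_holomorphic_onD[OF g S(2) this] obtain B
    where B: "bounded_clinear B" "(g has_derivative B) (at (f x))" .
  from bounded_clinear_compose[OF B(1) A(1)] has_derivative_compose[OF A(2) B(2)]
  show "\<exists>D. bounded_clinear D \<and> ((\<lambda>x. g (f x)) has_derivative D) (at x)" by blast
qed

lemma hilbert_holomorphic_on_diff:
  assumes f: "f hilbert_holomorphic_on S" and g: "g hilbert_holomorphic_on S" and S: "open S"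
  shows "(\<lambda>x. f x - g x) hilbert_holomorphic_on S"
proof (rule hilbert_holomorphic_onI)
  fix x assume x: "x \<in> S"
  obtain A where A: "bounded_clinear A" "(f has_derivative A) (at x)"
    by (rule hilbert_holomorphic_onD[OF f S x])
  obtain B where B: "bounded_clinear B" "(g has_derivative B) (at x)"
    by (rule hilbert_holomorphic_onD[OF g S x])
  from bounded_clinear_diff[OF A(1) B(1)] has_derivative_diff[OF A(2) B(2)]
  show "\<exists>D. bounded_clinear D \<and> ((\<lambda>x. f x - g x) has_derivative D) (at x)" by blast
qed

lemma hilbert_holomorphic_on_const: "(\<lambda>x. c) hilbert_holomorphic_on S"
  by (rule hilbert_holomorphic_onI) (use bounded_clinear_zero has_derivative_const in blast)

lemma bounded_clinear_imp_holomorphic: "bounded_clinear A \<Longrightarrow> A hilbert_holomorphic_on S"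
  by (rule hilbert_holomorphic_onI) (use bounded_linear_imp_has_derivative bounded_clinearD(1) in blast)

lemma hilbert_holomorphic_on_imp_continuous_on:
  "f hilbert_holomorphic_on S \<Longrightarrow> continuous_on S f"
  unfolding hilbert_holomorphic_on_def continuous_on_eq_continuous_within
  by (blast intro: has_derivative_continuous)

lemma differential_eq_derivative:
  assumes "(f has_derivative D) (at p)" "bounded_clinear D"
  shows "differential f p = D"
proof
  fix v
  have *: "((\<lambda>h. p + h *\<^sub>C v) has_derivative (\<lambda>h. h *\<^sub>C v)) (at 0)"
    using has_derivative_add[OF has_derivative_const
        bounded_linear.has_derivative[OF bounded_linear_scaleC_left has_derivative_ident]]
    by simp
  have "((\<lambda>h::complex. f (p + h *\<^sub>C v)) has_derivative (\<lambda>h. D (h *\<^sub>C v))) (at 0)"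
    by (rule has_derivative_compose[OF *]) (use assms in simp)
  then have lim: "((\<lambda>h::complex. norm (f (p + h *\<^sub>C v) - f p - h *\<^sub>C D v) / norm h) \<longlongrightarrow> 0) (at 0)"
    by (simp add: has_derivative_at bounded_clinearD(2)[OF assms(2)])
  have "norm (f (p + h *\<^sub>C v) - f p - h *\<^sub>C D v) / norm h
      = norm (inverse h *\<^sub>C (f (p + h *\<^sub>C v) - f p) - D v)" if "h \<noteq> 0" for h :: complex
  proof -
    have "inverse h *\<^sub>C (f (p + h *\<^sub>C v) - f p) - D v = inverse h *\<^sub>C (f (p + h *\<^sub>C v) - f p - h *\<^sub>C D v)"
      using that by (simp add: scaleC_diff_right scaleC_scaleC scaleC_one)
    then show ?thesis by (simp add: norm_inverse divide_inverse mult.commute)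
  qed
  then have "((\<lambda>h::complex. norm (inverse h *\<^sub>C (f (p + h *\<^sub>C v) - f p) - D v)) \<longlongrightarrow> 0) (at 0)"
    by (intro Lim_transform_eventually[OF lim]) (simp add: eventually_at_filter)
  then have "((\<lambda>h::complex. inverse h *\<^sub>C (f (p + h *\<^sub>C v) - f p)) \<longlongrightarrow> D v) (at 0)"
    by (rule Lim_null[THEN iffD2, OF tendsto_norm_zero_cancel])
  then show "differential f p v = D v"
    unfolding differential_def by (intro tendsto_Lim) auto
qed

section \<open>Iterates of a self-map\<close>

lemma funpow_into: "f ` S \<subseteq> S \<Longrightarrow> x \<in> S \<Longrightarrow> (f ^^ n) x \<in> S"
  by (induction n) auto

lemma hilbert_holomorphic_on_funpow:
  assumes f: "f hilbert_holomorphic_on S" "open S" "f ` S \<subseteq> S"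
  shows "(f ^^ n) hilbert_holomorphic_on S"
proof (induction n)
  case 0
  then show ?case
    using bounded_clinear_imp_holomorphic[OF bounded_clinear_ident] by (simp add: id_def)
next
  case (Suc n)
  have "(\<lambda>x. f ((f ^^ n) x)) hilbert_holomorphic_on S"
    by (rule hilbert_holomorphic_on_compose[OF Suc f(1,2,2)]) (use funpow_into[OF f(3)] in blast)
  then show ?case by (simp add: o_def)
qed

lemma has_derivative_funpow_fixpoint:
  assumes "(f has_derivative T) (at p)" "f p = p"
  shows "((f ^^ n) has_derivative (T ^^ n)) (at p)"
proof (induction n)
  case 0
  then show ?case by (simp add: id_def)
next
  case (Suc n)
  have fix_p: "(f ^^ n) p = p" by (induction n) (auto simp: assms(2))
  from has_derivative_compose[OF Suc, of f T] show ?case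
    using assms(1) by (simp add: fix_p o_def)
qed

section \<open>Power bounded triangularizable operators\<close>

text \<open>The linear span of the eigenvectors for clinear \<open>T\<close>, with at most one
  summand per eigenvalue. Extending the family by 0 off \<open>\<Lambda>\<close> lets two
  representations be added over the union of their index sets, and makes the component at any
  \<open>\<nu>\<close> simply \<open>w \<nu>\<close>.\<close>

definition eigenspan :: "('a::complex_inner \<Rightarrow> 'a) \<Rightarrow> 'a set" where
  "eigenspan T = {\<Sum>\<nu>\<in>\<Lambda>. w \<nu> | \<Lambda> w. finite \<Lambda> \<and> (\<forall>\<nu>. T (w \<nu>) = \<nu> *\<^sub>C w \<nu>) \<and> (\<forall>\<nu>. \<nu> \<notin> \<Lambda> \<longrightarrow> w \<nu> = 0)}"

lemma eigenspanE:
  assumes "x \<in> eigenspan T"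
  obtains \<Lambda> w where "finite \<Lambda>" "\<And>\<nu>. T (w \<nu>) = \<nu> *\<^sub>C w \<nu>" "\<And>\<nu>. \<nu> \<notin> \<Lambda> \<Longrightarrow> w \<nu> = 0" "x = sum w \<Lambda>"
  using assms unfolding eigenspan_def mem_Collect_eq by (elim exE conjE) (rule that; simp)

lemma eigenspanI:
  assumes "finite \<Lambda>" "\<And>\<nu>. T (w \<nu>) = \<nu> *\<^sub>C w \<nu>" "\<And>\<nu>. \<nu> \<notin> \<Lambda> \<Longrightarrow> w \<nu> = 0"
  shows "sum w \<Lambda> \<in> eigenspan T"
  unfolding eigenspan_def mem_Collect_eq by (rule exI[of _ \<Lambda>], rule exI[of _ w]) (simp add: assms)

context
  fixes T :: "'a::complex_inner \<Rightarrow> 'a"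
  assumes T: "bounded_clinear T"
begin

lemma bounded_clinear_simps: "T (x + y) = T x + T y" "T (x - y) = T x - T y" "T (c *\<^sub>C x) = c *\<^sub>C T x"
    "T 0 = 0" "T (sum f A) = (\<Sum>i\<in>A. T (f i))"
proof -
  interpret bounded_linear T by (rule bounded_clinearD(1)[OF T])
  show "T (x + y) = T x + T y" "T (x - y) = T x - T y" "T 0 = 0" "T (sum f A) = (\<Sum>i\<in>A. T (f i))"
    by (rule add diff zero sum)+
  show "T (c *\<^sub>C x) = c *\<^sub>C T x"
    by (rule bounded_clinearD(2)[OF T])
qed

lemma eigenvector_in_eigenspan:
  assumes "T x = \<nu> *\<^sub>C x"
  shows "x \<in> eigenspan T"
proof -
  have "(\<Sum>\<mu>\<in>{\<nu>}. if \<mu> = \<nu> then x else 0) \<in> eigenspan T"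
    by (rule eigenspanI) (auto simp: assms bounded_clinear_simps)
  then show ?thesis by simp
qed

lemma eigenspan_add:
  assumes "x \<in> eigenspan T" "y \<in> eigenspan T"
  shows "x + y \<in> eigenspan T"
proof -
  obtain \<Lambda> v where v: "finite \<Lambda>" "\<And>\<nu>. T (v \<nu>) = \<nu> *\<^sub>C v \<nu>" "\<And>\<nu>. \<nu> \<notin> \<Lambda> \<Longrightarrow> v \<nu> = 0" "x = sum v \<Lambda>"
    by (rule eigenspanE[OF assms(1)], rule that; blast)
  obtain M w where w: "finite M" "\<And>\<nu>. T (w \<nu>) = \<nu> *\<^sub>C w \<nu>" "\<And>\<nu>. \<nu> \<notin> M \<Longrightarrow> w \<nu> = 0" "y = sum w M"
    by (rule eigenspanE[OF assms(2)], rule that; blast)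
  have "x = sum v (\<Lambda> \<union> M)" "y = sum w (\<Lambda> \<union> M)"
    using v w by (auto intro!: sum.mono_neutral_left)
  then have "x + y = (\<Sum>\<nu>\<in>\<Lambda> \<union> M. v \<nu> + w \<nu>)"
    by (simp add: sum.distrib)
  moreover have "\<dots> \<in> eigenspan T"
    by (rule eigenspanI) (use v w in \<open>auto simp: bounded_clinear_simps scaleC_add_right\<close>)
  ultimately show ?thesis by simp
qed

lemma eigenspan_scaleC:
  assumes "x \<in> eigenspan T"
  shows "c *\<^sub>C x \<in> eigenspan T"
proof -
  obtain \<Lambda> v where v: "finite \<Lambda>" "\<And>\<nu>. T (v \<nu>) = \<nu> *\<^sub>C v \<nu>" "\<And>\<nu>. \<nu> \<notin> \<Lambda> \<Longrightarrow> v \<nu> = 0" "x = sum v \<Lambda>"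
    by (rule eigenspanE[OF assms(1)], rule that; blast)
  have "(\<Sum>\<nu>\<in>\<Lambda>. c *\<^sub>C v \<nu>) \<in> eigenspan T"
    by (rule eigenspanI) (use v in \<open>auto simp: bounded_clinear_simps scaleC_scaleC mult.commute\<close>)
  then show ?thesis by (simp add: v scaleC_sum_right)
qed

lemma eigenspan_sum: "(\<And>i. i \<in> A \<Longrightarrow> f i \<in> eigenspan T) \<Longrightarrow> sum f A \<in> eigenspan T"
proof (induction A rule: infinite_finite_induct)
  case (insert x A)
  then show ?case by (simp add: eigenspan_add)
qed (use eigenvector_in_eigenspan[of 0 0] bounded_clinear_simps in auto)

lemma eigenvalue_in_op_spectrum:
  assumes "T v = \<nu> *\<^sub>C v" "v \<noteq> 0"
  shows "\<nu> \<in> op_spectrum T"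
proof -
  have False if S: "bounded_clinear S" "S \<circ> (\<lambda>x. T x - \<nu> *\<^sub>C x) = id" for S
  proof -
    have "v = S 0"
      using fun_cong[OF S(2), of v] assms(1) by simp
    also have "\<dots> = 0"
      using bounded_clinearD(2)[OF S(1), of 0 0] by simp
    finally show False using assms(2) by simp
  qed
  then show ?thesis
    unfolding op_spectrum_def op_invertible_def by blast
qed

lemma funpow_eigenvector: "T x = \<nu> *\<^sub>C x \<Longrightarrow> (T ^^ n) x = \<nu> ^ n *\<^sub>C x"
  by (induction n) (auto simp: bounded_clinear_simps scaleC_one scaleC_scaleC mult.commute)

text \<open>For unimodular \<open>\<nu>\<close> the second coefficient grows linearly in
  \<open>n\<close>, which bounded powers do not permit. At \<open>n = 0\<close> the truncated
  exponent is harmless since its factor vanishes.\<close>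

lemma funpow_jordan_block:
  assumes "T x = \<nu> *\<^sub>C x + y" "T y = \<nu> *\<^sub>C y"
  shows "(T ^^ n) x = \<nu> ^ n *\<^sub>C x + (of_nat n * \<nu> ^ (n - 1)) *\<^sub>C y"
proof (induction n)
  case (Suc n)
  have c: "of_nat n * \<nu> ^ (n - 1) * \<nu> = of_nat n * \<nu> ^ n" by (cases n) auto
  have "(T ^^ Suc n) x = \<nu> ^ n *\<^sub>C (\<nu> *\<^sub>C x + y) + (of_nat n * \<nu> ^ (n - 1)) *\<^sub>C \<nu> *\<^sub>C y"
    by (simp add: Suc bounded_clinear_simps assms)
  also have "\<dots> = (\<nu> ^ n * \<nu>) *\<^sub>C x + (\<nu> ^ n *\<^sub>C y + (of_nat n * \<nu> ^ (n - 1) * \<nu>) *\<^sub>C y)"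
    by (simp add: scaleC_add_right scaleC_scaleC add.assoc)
  also have "\<dots> = \<nu> ^ Suc n *\<^sub>C x + (of_nat (Suc n) * \<nu> ^ (Suc n - 1)) *\<^sub>C y"
    unfolding c by (simp add: scaleC_add_left distrib_right mult.commute[of \<nu>])
  finally show ?case .
qed (simp add: scaleC_one)

lemma funpow_clinear_simps: "(T ^^ n) (x + y) = (T ^^ n) x + (T ^^ n) y"
    "(T ^^ n) (x - y) = (T ^^ n) x - (T ^^ n) y" "(T ^^ n) (c *\<^sub>C x) = c *\<^sub>C (T ^^ n) x"
    "(T ^^ n) 0 = 0"
  by (induction n) (auto simp: bounded_clinear_simps)

lemma funpow_clinear_sum: "(T ^^ n) (sum f A) = (\<Sum>i\<in>A. (T ^^ n) (f i))"
  by (induction n arbitrary: f) (auto simp: bounded_clinear_simps)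

lemma bounded_clinear_funpow: "bounded_clinear (T ^^ n)"
proof (induction n)
  case 0
  then show ?case by (simp add: bounded_clinear_def id_def bounded_linear_ident)
next
  case (Suc n)
  then show ?case
    using bounded_linear_compose[of T "T ^^ n"] bounded_clinearD(1)[OF T]
    by (auto simp: bounded_clinear_def bounded_clinear_simps funpow_clinear_simps o_def)
qed

context
  fixes K :: real
  assumes K: "\<And>n x. norm ((T ^^ n) x) \<le> K * norm x"
    and sp: "op_spectrum T \<subseteq> sphere 0 1"
begin

lemma eigenvalue_unimodular: "T v = \<nu> *\<^sub>C v \<Longrightarrow> v \<noteq> 0 \<Longrightarrow> norm \<nu> = 1"
  using subsetD[OF sp eigenvalue_in_op_spectrum] by simp

text \<open>Power boundedness excludes Jordan blocks.\<close>

lemma eigenspan_triangular_step: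
  assumes y: "y \<in> eigenspan T" and x: "T x = \<nu> *\<^sub>C x + y"
  shows "x \<in> eigenspan T"
proof -
  obtain \<Lambda> w where w: "finite \<Lambda>" "\<And>\<nu>. T (w \<nu>) = \<nu> *\<^sub>C w \<nu>" "\<And>\<nu>. \<nu> \<notin> \<Lambda> \<Longrightarrow> w \<nu> = 0" "y = sum w \<Lambda>"
    by (rule eigenspanE[OF y], rule that; blast)
  \<comment> \<open>Solves \<open>\<nu> *\<^sub>C u - T u = sum w (\<Lambda> - {\<nu>})\<close>
    componentwise, so that replacing \<open>x\<close> by \<open>x + u\<close> leaves only the
    resonant component \<open>w \<nu>\<close>: a pure Jordan block.\<close>
  define u where "u = (\<Sum>\<mu>\<in>\<Lambda> - {\<nu>}. inverse (\<nu> - \<mu>) *\<^sub>C w \<mu>)"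
  have u: "u \<in> eigenspan T"
    unfolding u_def by (intro eigenspan_sum eigenspan_scaleC eigenvector_in_eigenspan[OF w(2)])
  have y_split: "y = w \<nu> + sum w (\<Lambda> - {\<nu>})"
    using w sum.remove[of \<Lambda> \<nu> w] by (cases "\<nu> \<in> \<Lambda>") auto
  have "\<nu> *\<^sub>C u - T u = (\<Sum>\<mu>\<in>\<Lambda> - {\<nu>}. ((\<nu> - \<mu>) * inverse (\<nu> - \<mu>)) *\<^sub>C w \<mu>)"
    by (simp add: u_def bounded_clinear_simps w(2) scaleC_sum_right scaleC_scaleC sum_subtractf[symmetric]
        scaleC_diff_left[symmetric] left_diff_distrib mult.commute)
  also have "\<dots> = sum w (\<Lambda> - {\<nu>})"
    by (intro sum.cong) (auto simp: scaleC_one)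
  finally have u_eq: "T u = \<nu> *\<^sub>C u - sum w (\<Lambda> - {\<nu>})" by (simp add: algebra_simps)
  have block: "T (x + u) = \<nu> *\<^sub>C (x + u) + w \<nu>"
    unfolding bounded_clinear_simps(1) x u_eq y_split by (simp add: scaleC_add_right)
  have "w \<nu> = 0"
  proof (rule ccontr)
    assume nz: "w \<nu> \<noteq> 0"
    then have nu: "norm \<nu> = 1" using eigenvalue_unimodular w(2) by blast
    obtain n where n: "(K + 1) * norm (x + u) < real n * norm (w \<nu>)"
      using ex_less_of_nat_mult[of "norm (w \<nu>)"] nz by auto
    have "real n * norm (w \<nu>) = norm ((T ^^ n) (x + u) - \<nu> ^ n *\<^sub>C (x + u))"
      by (simp add: funpow_jordan_block[OF block w(2)] norm_mult norm_power nu)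
    also have "\<dots> \<le> norm ((T ^^ n) (x + u)) + norm (x + u)"
      using norm_triangle_ineq4[of "(T ^^ n) (x + u)" "\<nu> ^ n *\<^sub>C (x + u)"] by (simp add: norm_power nu)
    also have "\<dots> \<le> (K + 1) * norm (x + u)"
      using K[of n "x + u"] by (simp add: distrib_right)
    finally show False using n by simp
  qed
  then have "x + u \<in> eigenspan T"
    using block by (intro eigenvector_in_eigenspan[of _ \<nu>]) simp
  from eigenspan_add[OF this eigenspan_scaleC[OF u, of "- 1"]] show ?thesis
    by (simp add: scaleC_minus_left scaleC_one)
qed

text \<open>By strong induction: \<open>T (e n)\<close> is the diagonal multiple \<open>c n\<close>
  of \<open>e n\<close> plus a combination of earlier basis vectors, exactly the situation of the
  preceding step.\<close>

lemma triangular_basis_in_eigenspan: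
  assumes inv: "\<And>N. N \<ge> 1 \<Longrightarrow> enat N \<le> d \<Longrightarrow> T ` flag e N \<subseteq> flag e N"
  shows "enat n < d \<Longrightarrow> e n \<in> eigenspan T"
proof (induction n rule: less_induct)
  case (less n)
  have "e n = (\<Sum>k<Suc n. (if k = n then 1 else 0) *\<^sub>C e k)"
    by (simp add: scaleC_one)
  then have "e n \<in> flag e (Suc n)"
    unfolding flag_def by (auto intro!: exI[of _ "\<lambda>k. if k = n then 1 else 0"])
  moreover have "enat (Suc n) \<le> d"
    using less.prems by (simp add: Suc_ile_eq)
  ultimately have "T (e n) \<in> flag e (Suc n)"
    using inv[of "Suc n"] by auto
  then obtain c where c: "T (e n) = (\<Sum>k<Suc n. c k *\<^sub>C e k)"
    by (auto simp: flag_def)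
  have "e k \<in> eigenspan T" if "k < n" for k
    using less that by (meson enat_ord_simps(2) less_trans)
  then have "(\<Sum>k<n. c k *\<^sub>C e k) \<in> eigenspan T"
    by (intro eigenspan_sum eigenspan_scaleC) auto
  then show ?case
    by (rule eigenspan_triangular_step[of _ _ "c n"]) (simp add: c add.commute)
qed

end

end

section \<open>Recurrence of powers\<close>

lemma unimodular_convergent_powers:
  fixes \<Lambda> :: "complex set"
  assumes "finite \<Lambda>" "\<And>\<nu>. \<nu> \<in> \<Lambda> \<Longrightarrow> norm \<nu> = 1"
  shows "\<exists>r::nat \<Rightarrow> nat. strict_mono r \<and> (\<forall>\<nu>\<in>\<Lambda>. convergent (\<lambda>n. \<nu> ^ r n))"
  using assms
proof (induction \<Lambda> rule: finite_induct)
  case empty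
  then show ?case using strict_mono_id by blast
next
  case (insert \<nu> \<Lambda>)
  then obtain r :: "nat \<Rightarrow> nat" where r: "strict_mono r" "\<And>\<nu>. \<nu> \<in> \<Lambda> \<Longrightarrow> convergent (\<lambda>n. \<nu> ^ r n)"
    by auto
  \<comment> \<open>Subsequences are extracted one eigenvalue at a time; those already treated keep
    converging.\<close>
  have "seq_compact (sphere (0::complex) 1)"
    by (simp add: compact_imp_seq_compact)
  then obtain l s where s: "strict_mono s" "((\<lambda>n. \<nu> ^ r n) \<circ> s) \<longlonglongrightarrow> l"
    using insert.prems by (elim seq_compactE[of _ "\<lambda>n. \<nu> ^ r n"]) (auto simp: norm_power)
  have "convergent (\<lambda>n. \<mu> ^ (r \<circ> s) n)" if "\<mu> \<in> insert \<nu> \<Lambda>" for \<mu>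
  proof (cases "\<mu> = \<nu>")
    case True
    then show ?thesis using s by (auto simp: convergent_def o_def)
  next
    case False
    then show ?thesis
      using convergent_subseq_convergent[OF r(2) s(1), of \<mu>] that by (simp add: o_def)
  qed
  moreover have "strict_mono (r \<circ> s)" using r s by (simp add: strict_mono_o)
  ultimately show ?case by blast
qed

text \<open>Two powers from a convergent subsequence are close; dividing by the smaller one, of
  modulus 1, moves the closeness to 1. Taking indices \<open>m\<close> apart makes the difference of
  exponents at least \<open>m\<close>.\<close>

lemma unimodular_simultaneous_recurrence:
  fixes \<Lambda> :: "complex set"
  assumes "finite \<Lambda>" "\<And>\<nu>. \<nu> \<in> \<Lambda> \<Longrightarrow> norm \<nu> = 1" "\<epsilon> > 0"
  shows "\<exists>n\<ge>m. \<forall>\<nu>\<in>\<Lambda>. norm (\<nu> ^ n - 1) < \<epsilon>"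
proof -
  obtain r :: "nat \<Rightarrow> nat" where r: "strict_mono r" "\<And>\<nu>. \<nu> \<in> \<Lambda> \<Longrightarrow> convergent (\<lambda>n. \<nu> ^ r n)"
    using unimodular_convergent_powers[OF assms(1,2)] by blast
  have "eventually (\<lambda>N. dist (\<nu> ^ r (N + m)) (\<nu> ^ r N) < \<epsilon>) sequentially" if l: "\<nu> \<in> \<Lambda>" for \<nu>
  proof -
    have "Cauchy (\<lambda>n. \<nu> ^ r n)" using convergent_Cauchy[OF r(2)[OF l]] .
    from metric_CauchyD[OF this assms(3)] obtain M
      where "\<And>i j. i \<ge> M \<Longrightarrow> j \<ge> M \<Longrightarrow> dist (\<nu> ^ r i) (\<nu> ^ r j) < \<epsilon>" by blast
    then show ?thesis unfolding eventually_sequentially by (metis trans_le_add1)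
  qed
  then have "eventually (\<lambda>N. \<forall>\<nu>\<in>\<Lambda>. dist (\<nu> ^ r (N + m)) (\<nu> ^ r N) < \<epsilon>) sequentially"
    by (intro eventually_ball_finite assms(1)) auto
  then obtain N where N: "\<And>\<nu>. \<nu> \<in> \<Lambda> \<Longrightarrow> dist (\<nu> ^ r (N + m)) (\<nu> ^ r N) < \<epsilon>"
    using eventually_happens'[OF sequentially_bot] by blast
  have le: "r N + m \<le> r (N + m)"
  proof (induction m)
    case (Suc m)
    have "r (N + m) < r (N + Suc m)" using r(1) by (simp add: strict_mono_def)
    then show ?case using Suc by simp
  qed simp
  have "norm (\<nu> ^ (r (N + m) - r N) - 1) < \<epsilon>" if l: "\<nu> \<in> \<Lambda>" for \<nu>
  proof -
    have "\<nu> ^ r (N + m) - \<nu> ^ r N = \<nu> ^ r N * (\<nu> ^ (r (N + m) - r N) - 1)"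
      using le by (simp add: right_diff_distrib power_add[symmetric])
    then have "norm (\<nu> ^ r (N + m) - \<nu> ^ r N) = norm (\<nu> ^ (r (N + m) - r N) - 1)"
      by (simp add: norm_mult norm_power assms(2)[OF l])
    then show ?thesis using N[OF l] by (simp add: dist_norm)
  qed
  then show ?thesis using le by (intro exI[of _ "r (N + m) - r N"]) auto
qed

lemma eigenspan_simultaneous_recurrence:
  fixes T :: "'a::complex_inner \<Rightarrow> 'a"
  assumes T: "bounded_clinear T" and sp: "op_spectrum T \<subseteq> sphere 0 1"
    and X: "finite X" "X \<subseteq> eigenspan T" and "\<epsilon> > 0"
  shows "\<exists>n\<ge>m. \<forall>x\<in>X. norm ((T ^^ n) x - x) < \<epsilon>"
proof -
  have "\<exists>\<Lambda> w. finite \<Lambda> \<and> (\<forall>\<nu>. T (w \<nu>) = \<nu> *\<^sub>C w \<nu>) \<and> x = sum w \<Lambda>" if "x \<in> X" for x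
    by (rule eigenspanE[OF subsetD[OF X(2) that]]) blast
  then obtain \<Lambda> w where w: "\<And>x. x \<in> X \<Longrightarrow> finite (\<Lambda> x)"
      "\<And>x \<nu>. x \<in> X \<Longrightarrow> T (w x \<nu>) = \<nu> *\<^sub>C w x \<nu>" "\<And>x. x \<in> X \<Longrightarrow> x = sum (w x) (\<Lambda> x)"
    by metis
  \<comment> \<open>An index with zero component need not be an eigenvalue, so only unimodular ones
    are kept. Below, the 1 added to \<open>B\<close> avoids division by zero.\<close>
  define M where "M = {\<nu>\<in>(\<Union>x\<in>X. \<Lambda> x). norm \<nu> = 1}"
  define B where "B = (\<Sum>x\<in>X. \<Sum>\<nu>\<in>\<Lambda> x. norm (w x \<nu>))"
  have B0: "B \<ge> 0" by (auto simp: B_def intro!: sum_nonneg)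
  have "finite M" using X w(1) by (auto simp: M_def)
  then have "\<exists>n\<ge>m. \<forall>\<nu>\<in>M. norm (\<nu> ^ n - 1) < \<epsilon> / (B + 1)"
    by (rule unimodular_simultaneous_recurrence) (use B0 \<open>\<epsilon> > 0\<close> in \<open>auto simp: M_def\<close>)
  then obtain n where n: "n \<ge> m" "\<And>\<nu>. \<nu> \<in> M \<Longrightarrow> norm (\<nu> ^ n - 1) < \<epsilon> / (B + 1)"
    by blast
  have "norm ((T ^^ n) x - x) < \<epsilon>" if x: "x \<in> X" for x
  proof -
    have "(T ^^ n) x - x = (\<Sum>\<nu>\<in>\<Lambda> x. (\<nu> ^ n - 1) *\<^sub>C w x \<nu>)"
      by (subst (1 2) w(3)[OF x]) (simp add: funpow_clinear_sum[OF T] funpow_eigenvector[OF T w(2)[OF x]]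
          sum_subtractf[symmetric] scaleC_diff_left scaleC_one)
    also have "norm \<dots> \<le> (\<Sum>\<nu>\<in>\<Lambda> x. \<epsilon> / (B + 1) * norm (w x \<nu>))"
    proof (rule sum_norm_le)
      fix \<nu> assume l: "\<nu> \<in> \<Lambda> x"
      show "norm ((\<nu> ^ n - 1) *\<^sub>C w x \<nu>) \<le> \<epsilon> / (B + 1) * norm (w x \<nu>)"
      proof (cases "w x \<nu> = 0")
        case False
        then have "norm \<nu> = 1"
          using subsetD[OF sp eigenvalue_in_op_spectrum[OF T w(2)[OF x] False]] by simp
        then have "norm (\<nu> ^ n - 1) \<le> \<epsilon> / (B + 1)"
          using l x by (intro less_imp_le n) (auto simp: M_def)
        then show ?thesis unfolding norm_scaleC by (rule mult_right_mono) simp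
      qed simp
    qed
    also have "\<dots> \<le> \<epsilon> / (B + 1) * B"
      unfolding sum_distrib_left[symmetric] B_def
      using X x B0 \<open>\<epsilon> > 0\<close>
      by (intro mult_left_mono member_le_sum[of x X "\<lambda>x. \<Sum>\<nu>\<in>\<Lambda> x. norm (w x \<nu>)"])
        (auto intro!: sum_nonneg simp: B_def[symmetric])
    also have "\<dots> < \<epsilon>" using B0 \<open>\<epsilon> > 0\<close> by (simp add: field_simps)
    finally show ?thesis .
  qed
  with n(1) show ?thesis by blast
qed

text \<open>A diagonal choice: the exponent \<open>r k\<close> returns the first \<open>k\<close>
  basis vectors to within \<open>1 / Suc k\<close>. The uniform bound on the powers carries this
  from partial sums of the basis expansion to every vector. Since \<open>k < r k\<close>, the
  exponents eventually exceed any given number and are never 0.\<close>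

lemma triangularizable_power_recurrence:
  fixes T :: "'a::complex_inner \<Rightarrow> 'a"
  assumes T: "bounded_clinear T" and tri: "triangularizable T" and sp: "op_spectrum T \<subseteq> sphere 0 1"
    and K: "\<And>n x. norm ((T ^^ n) x) \<le> K * norm x"
  obtains r where "\<And>k::nat. k < r k" "\<And>x. (\<lambda>k. (T ^^ r k) x) \<longlonglongrightarrow> x"
proof -
  obtain d e where basis: "is_basis d e" and inv: "\<And>N. N \<ge> 1 \<Longrightarrow> enat N \<le> d \<Longrightarrow> T ` flag e N \<subseteq> flag e N"
    using tri unfolding triangularizable_def by blast
  note eig = triangular_basis_in_eigenspan[OF T K sp inv]
  have "\<exists>n>k. \<forall>x\<in>{e i | i. i < k \<and> enat i < d}. norm ((T ^^ n) x - x) < 1 / Suc k" for k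
    using eigenspan_simultaneous_recurrence[OF T sp, of "{e i | i. i < k \<and> enat i < d}" "1 / Suc k" "Suc k"] eig
    by (auto simp: Suc_le_eq)
  then obtain r where r: "\<And>k. k < r k"
      "\<And>k i. i < k \<Longrightarrow> enat i < d \<Longrightarrow> norm ((T ^^ r k) (e i) - e i) < 1 / Suc k"
    by (metis (mono_tags, lifting) mem_Collect_eq)
  have lim_e: "(\<lambda>k. (T ^^ r k) (e i)) \<longlonglongrightarrow> e i" if "enat i < d" for i
  proof (rule Lim_null[THEN iffD2], rule Lim_null_comparison)
    show "eventually (\<lambda>k. norm ((T ^^ r k) (e i) - e i) \<le> 1 / Suc k) sequentially"
      using eventually_gt_at_top[of i] by eventually_elim (use r(2) that in \<open>auto intro: less_imp_le\<close>)
    show "(\<lambda>k. 1 / real (Suc k)) \<longlonglongrightarrow> 0"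
      by (rule LIMSEQ_Suc[OF lim_1_over_n])
  qed
  have "(\<lambda>k. (T ^^ r k) x) \<longlonglongrightarrow> x" for x
  proof (rule metric_LIMSEQ_I)
    fix \<epsilon> :: real assume \<epsilon>: "\<epsilon> > 0"
    define Q where "Q = \<bar>K\<bar> + 1"
    have Q: "Q \<ge> 1" "\<bar>K\<bar> \<le> Q" by (auto simp: Q_def)
    obtain c where c: "\<And>n. d \<le> enat n \<Longrightarrow> c n = 0" "(\<lambda>n. c n *\<^sub>C e n) sums x"
      using basis unfolding is_basis_def by blast
    have "\<epsilon> / (3 * Q) > 0" using \<epsilon> Q by simp
    then obtain N where "dist (\<Sum>n<N. c n *\<^sub>C e n) x < \<epsilon> / (3 * Q)"
      using c(2) unfolding sums_def lim_sequentially by blast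
    then obtain s where s: "s = (\<Sum>n<N. c n *\<^sub>C e n)" "norm (x - s) < \<epsilon> / (3 * Q)"
      by (metis dist_commute dist_norm)
    have "(\<lambda>k. \<Sum>n<N. c n *\<^sub>C (T ^^ r k) (e n)) \<longlonglongrightarrow> (\<Sum>n<N. c n *\<^sub>C e n)"
    proof (rule tendsto_sum)
      fix n
      show "(\<lambda>k. c n *\<^sub>C (T ^^ r k) (e n)) \<longlonglongrightarrow> c n *\<^sub>C e n"
      proof (cases "enat n < d")
        case True
        show ?thesis
          by (rule bounded_linear.tendsto[OF bounded_linear_scaleC_right lim_e[OF True]])
      qed (use c(1)[of n] in auto)
    qed
    then have "(\<lambda>k. (T ^^ r k) s) \<longlonglongrightarrow> s"
      by (simp add: s funpow_clinear_sum[OF T] funpow_clinear_simps(3)[OF T])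
    then obtain k0 where k0: "\<And>k. k \<ge> k0 \<Longrightarrow> norm ((T ^^ r k) s - s) < \<epsilon> / 3"
      using \<epsilon> unfolding lim_sequentially dist_norm by (meson divide_pos_pos zero_less_numeral)
    have "dist ((T ^^ r k) x) x < \<epsilon>" if "k \<ge> k0" for k
    proof -
      have "\<bar>K\<bar> * norm (x - s) \<le> Q * (\<epsilon> / (3 * Q))"
        using s(2) Q by (intro mult_mono) auto
      then have 1: "\<bar>K\<bar> * norm (x - s) \<le> \<epsilon> / 3" using Q by simp
      have "\<epsilon> / (3 * Q) \<le> \<epsilon> / 3"
        using \<epsilon> Q by (intro divide_left_mono) auto
      then have 2: "norm (x - s) < \<epsilon> / 3" using s(2) by simp
      have "norm ((T ^^ r k) (x - s)) \<le> \<bar>K\<bar> * norm (x - s)"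
        using K[of "r k" "x - s"] by (rule order_trans) (simp add: mult_right_mono)
      then have 3: "norm ((T ^^ r k) (x - s)) \<le> \<epsilon> / 3" using 1 by simp
      have "(T ^^ r k) x - x = (T ^^ r k) (x - s) + ((T ^^ r k) s - s) - (x - s)"
        by (simp add: funpow_clinear_simps[OF T])
      then have "norm ((T ^^ r k) x - x) \<le> norm ((T ^^ r k) (x - s)) + norm ((T ^^ r k) s - s) + norm (x - s)"
        by (metis norm_triangle_ineq norm_triangle_ineq4 add_right_mono order_trans)
      then show ?thesis
        using 2 3 k0[OF that] by (simp add: dist_norm)
    qed
    then show "\<exists>no. \<forall>n\<ge>no. dist ((T ^^ r n) x) x < \<epsilon>" by blast
  qed
  with r(1) that show thesis by blast
qed

lemma funpow_right_inverse:
  fixes T S :: "'a \<Rightarrow> 'a"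
  assumes "\<And>x. T (S x) = x"
  shows "(T ^^ n) ((S ^^ n) x) = x"
proof (induction n)
  case (Suc n)
  have "(T ^^ Suc n) ((S ^^ Suc n) x) = (T ^^ n) (T (S ((S ^^ n) x)))"
    by (simp only: funpow_Suc_right[of n T] funpow.simps(2)[of n S] o_apply)
  then show ?case by (simp only: assms Suc)
qed simp

text \<open>For large \<open>k\<close>, applying \<open>T ^^ r k\<close> to
  \<open>(S ^^ n) x\<close> gives \<open>(T ^^ (r k - n)) x\<close>, bounded by
  \<open>K * norm x\<close>, while by recurrence it tends to \<open>(S ^^ n) x\<close>.\<close>

lemma power_recurrence_inverse_bound:
  fixes T S :: "'a::real_normed_vector \<Rightarrow> 'a"
  assumes r: "\<And>k::nat. k < r k" "\<And>x. (\<lambda>k. (T ^^ r k) x) \<longlonglongrightarrow> x"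
    and K: "\<And>n x. norm ((T ^^ n) x) \<le> K * norm x" and TS: "\<And>x. T (S x) = x"
  shows "norm ((S ^^ n) x) \<le> K * norm x"
proof (rule tendsto_upperbound[OF tendsto_norm[OF r(2)]])
  show "\<forall>\<^sub>F k in sequentially. norm ((T ^^ r k) ((S ^^ n) x)) \<le> K * norm x"
    using eventually_ge_at_top[of n]
  proof eventually_elim
    case (elim k)
    then have "r k = (r k - n) + n" using r(1)[of k] by simp
    then have "(T ^^ r k) ((S ^^ n) x) = (T ^^ (r k - n)) x"
      by (metis funpow_right_inverse[of T S, OF TS] comp_apply funpow_add)
    then show ?case using K by simp
  qed
qed simp

section \<open>Linearization along orbits\<close>

text \<open>In place of weak compactness: near-minimal norm elements of decreasing convex sets are Cauchy by the
  parallelogram law.\<close>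

lemma convex_decseq_convergent_selection:
  fixes V :: "nat \<Rightarrow> 'a::{real_inner,complete_space} set"
  assumes convex: "\<And>n. convex (V n)" and nonempty: "\<And>n. V n \<noteq> {}"
    and dec: "decseq V" and bounded: "bounded (V 0)"
  obtains c y where "\<And>n. c n \<in> V n" "c \<longlonglongrightarrow> y"
proof -
  define d where "d n = (INF x\<in>V n. norm x)" for n
  have sub: "V n \<subseteq> V m" if "m \<le> n" for m n
    using decseqD[OF dec that] .
  obtain B where B: "\<And>x. x \<in> V 0 \<Longrightarrow> norm x \<le> B"
    using bounded by (auto simp: bounded_iff)
  have d_le: "d m \<le> norm x" if "x \<in> V m" for x m
    unfolding d_def by (rule cINF_lower[OF _ that]) (auto intro!: bdd_belowI[of _ 0])
  have "incseq d"
  proof (rule monoI)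
    fix m n :: nat assume "m \<le> n"
    show "d m \<le> d n"
      unfolding d_def[of n] by (rule cINF_greatest) (use nonempty d_le sub[OF \<open>m \<le> n\<close>] in auto)
  qed
  moreover have dB: "d n \<le> B" for n
    using nonempty[of n] d_le[of _ n] B sub[of 0 n] by (meson all_not_in_conv le0 order_trans subsetD)
  ultimately obtain L where L: "d \<longlonglongrightarrow> L" "\<And>n. d n \<le> L"
    using incseq_convergent[of d B] by blast
  have d0: "0 \<le> d n" for n
    unfolding d_def by (rule cINF_greatest) (use nonempty in auto)
  have "\<exists>x\<in>V n. norm x < d n + 1 / Suc n" for n
  proof (rule ccontr)
    assume "\<not> ?thesis"
    then have "d n + 1 / Suc n \<le> d n"
      unfolding d_def[of n] by (intro cINF_greatest nonempty) (auto simp: d_def not_less)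
    then show False by simp
  qed
  then obtain c where c: "\<And>n. c n \<in> V n" "\<And>n. norm (c n) < d n + 1 / Suc n"
    by metis
  \<comment> \<open>The parallelogram identity for \<open>c m\<close> and \<open>c n\<close> with
    \<open>m \<le> n\<close>: both norms are at most \<open>L + 1 / Suc m\<close>, and their
    midpoint lies in \<open>V m\<close>, so has norm at least \<open>d m\<close>.\<close>
  define a where "a m = 4 * ((L + 1 / Suc m)\<^sup>2 - (d m)\<^sup>2)" for m
  have "a \<longlonglongrightarrow> 4 * ((L + 0)\<^sup>2 - L\<^sup>2)"
    unfolding a_def by (intro tendsto_intros L LIMSEQ_Suc[OF lim_1_over_n])
  then have a: "a \<longlonglongrightarrow> 0" by simp
  have le: "(norm (c m - c n))\<^sup>2 \<le> a m" if "m \<le> n" for m n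
  proof -
    have "(1/2) *\<^sub>R c m + (1/2) *\<^sub>R c n \<in> V m"
      by (rule convexD[OF convex c(1)]) (use c(1)[of n] sub[OF that] in auto)
    from d_le[OF this] have "d m \<le> norm ((1/2) *\<^sub>R (c m + c n))"
      by (simp add: scaleR_add_right)
    then have "2 * d m \<le> norm (c m + c n)" by simp
    then have 1: "(2 * d m)\<^sup>2 \<le> (norm (c m + c n))\<^sup>2"
      using d0[of m] by (intro power_mono) auto
    have "norm (c k) \<le> L + 1 / Suc m" if "k \<ge> m" for k
    proof -
      have "1 / real (Suc k) \<le> 1 / Suc m" using that by (simp add: frac_le)
      then show ?thesis using c(2)[of k] L(2)[of k] by linarith
    qed
    then have 2: "(norm (c k))\<^sup>2 \<le> (L + 1 / Suc m)\<^sup>2" if "k \<ge> m" for k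
      using that by (intro power_mono) auto
    have "(norm (c m - c n))\<^sup>2 = 2 * (norm (c m))\<^sup>2 + 2 * (norm (c n))\<^sup>2 - (norm (c m + c n))\<^sup>2"
      by (simp add: power2_norm_eq_inner inner_add_left inner_add_right inner_diff_left
          inner_diff_right inner_commute)
    then show ?thesis
      using 1 2[of m] 2[of n] that by (simp add: a_def power_mult_distrib)
  qed
  have "Cauchy c"
  proof (rule CauchyI')
    fix e :: real assume e: "e > 0"
    then have "eventually (\<lambda>m. a m < e\<^sup>2) sequentially"
      by (intro order_tendstoD(2)[OF a]) auto
    then obtain M where M: "\<And>m. m \<ge> M \<Longrightarrow> a m < e\<^sup>2"
      by (auto simp: eventually_sequentially)
    have "dist (c m) (c n) < e" if "m \<ge> M" "m < n" for m n
    proof -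
      have "(norm (c m - c n))\<^sup>2 < e\<^sup>2"
        using le[of m n] M[of m] that by simp
      then show ?thesis
        using e by (simp add: dist_norm power_less_imp_less_base)
    qed
    then show "\<exists>M. \<forall>m\<ge>M. \<forall>n>m. dist (c m) (c n) < e" by blast
  qed
  then obtain y where "c \<longlonglongrightarrow> y"
    using Cauchy_convergent_iff convergent_def by blast
  with c(1) that show thesis by blast
qed

text \<open>The averages \<open>(1 / N) \<Sum>i<N. S\<^sup>i (f\<^sup>i - p)\<close>, where \<open>S\<close> is the inverse of the derivative \<open>T\<close>,
  conjugate \<open>f\<close> to \<open>T\<close> up to an error \<open>O(1 / N)\<close>. The conditions expressing this are convex in the
  conjugating map, so that for each point a strongly convergent selection exists.\<close>

lemma orbit_dominated_by_linear_orbit: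
  fixes f :: "'a::chilbert_space \<Rightarrow> 'a"
  assumes \<Omega>: "open \<Omega>" "bounded \<Omega>" "p \<in> \<Omega>" and f: "f ` \<Omega> \<subseteq> \<Omega>" "f hilbert_holomorphic_on \<Omega>" "f p = p"
    and T: "(f has_derivative T) (at p)" "bounded_clinear T"
    and S: "bounded_clinear S" "\<And>x. T (S x) = x" "\<And>x. S (T x) = x"
    and K: "\<And>n x. norm ((T ^^ n) x) \<le> K * norm x" "\<And>n x. norm ((S ^^ n) x) \<le> K * norm x" "K \<ge> 0"
  obtains \<rho> where "\<rho> > 0" "ball p \<rho> \<subseteq> \<Omega>"
    "\<And>x. x \<in> ball p \<rho> \<Longrightarrow>
      \<exists>y. \<forall>m m'. norm ((f ^^ m) x - (f ^^ m') x) \<le> 2 * norm ((T ^^ m) y - (T ^^ m') y)"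
proof -
  obtain B0 where B0: "\<And>x. x \<in> \<Omega> \<Longrightarrow> dist p x \<le> B0"
    using \<Omega>(2) unfolding bounded_any_center[where a = p] by blast
  define B where "B = \<bar>B0\<bar> + 1"
  have B: "norm (x - p) \<le> B" if "x \<in> \<Omega>" for x
    using B0[OF that] by (simp add: B_def dist_norm norm_minus_commute)
  have Bpos: "B > 0" by (simp add: B_def)
  define C where "C = K * B + B"
  have C: "C > 0" using K(3) Bpos by (simp add: C_def add_nonneg_pos)
  obtain r where r: "r > 0" "ball p r \<subseteq> \<Omega>"
    by (rule openE[OF \<Omega>(1,3)])
  have fn: "(f ^^ n) x \<in> \<Omega>" if "x \<in> \<Omega>" for n x
    using funpow_into[OF f(1) that] .
  have fp: "(f ^^ n) p = p" for n by (induction n) (auto simp: f(3))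
  note TS = funpow_right_inverse[of T S, OF S(2)] funpow_right_inverse[of S T, OF S(3)]
  \<comment> \<open>The deviation of one term of the average from \<open>x - p\<close>. It vanishes
    to second order at \<open>p\<close>, as the powers of \<open>S\<close> and \<open>T\<close>
    cancel, and is bounded by \<open>C\<close> independently of \<open>n\<close>.\<close>
  define h where "h n x = (S ^^ n) ((f ^^ n) x - p) - (x - p)" for n x
  have Sf_bd: "norm ((S ^^ n) ((f ^^ n) x - p)) \<le> K * B" if "x \<in> \<Omega>" for n x
    using order_trans[OF K(2) mult_left_mono[OF B[OF fn[OF that]] K(3)]] .
  have h_bd: "norm (h n x) \<le> C" if "x \<in> \<Omega>" for n x
    unfolding h_def C_def
    by (rule order_trans[OF norm_triangle_ineq4 add_mono[OF Sf_bd[OF that] B[OF that]]])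
  have h_hol: "h n hilbert_holomorphic_on \<Omega>" for n
  proof -
    have "(\<lambda>x. (f ^^ n) x - p) hilbert_holomorphic_on \<Omega>"
      by (intro hilbert_holomorphic_on_diff hilbert_holomorphic_on_funpow hilbert_holomorphic_on_const f \<Omega>)
    then have "(\<lambda>x. (S ^^ n) ((f ^^ n) x - p)) hilbert_holomorphic_on \<Omega>"
      by (rule hilbert_holomorphic_on_compose[OF _ bounded_clinear_imp_holomorphic[OF bounded_clinear_funpow[OF S(1)]]
            \<Omega>(1) open_UNIV]) auto
    then have "(\<lambda>x. (S ^^ n) ((f ^^ n) x - p) - (x - p)) hilbert_holomorphic_on \<Omega>"
      by (intro hilbert_holomorphic_on_diff \<Omega> bounded_clinear_imp_holomorphic[OF bounded_clinear_ident]
          hilbert_holomorphic_on_const)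
    then show ?thesis by (simp add: h_def[abs_def])
  qed
  have hp: "h n p = 0" for n
    using funpow_clinear_simps(4)[OF S(1)] by (simp add: h_def fp)
  have h_der: "(h n has_derivative (\<lambda>v. 0)) (at p)" for n
  proof -
    have "((\<lambda>x. (f ^^ n) x - p) has_derivative (\<lambda>v. (T ^^ n) v - 0)) (at p)"
      by (intro has_derivative_diff has_derivative_funpow_fixpoint T f has_derivative_const)
    then have "((\<lambda>x. (S ^^ n) ((f ^^ n) x - p)) has_derivative (\<lambda>v. (S ^^ n) ((T ^^ n) v - 0))) (at p)"
      by (rule bounded_linear.has_derivative[OF bounded_clinearD(1)[OF bounded_clinear_funpow[OF S(1)]]])
    then have "((\<lambda>x. (S ^^ n) ((f ^^ n) x - p) - (x - p)) has_derivative
        (\<lambda>v. (S ^^ n) ((T ^^ n) v - 0) - (v - 0))) (at p)"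
      by (intro has_derivative_diff has_derivative_ident has_derivative_const)
    then show ?thesis by (simp add: h_def[abs_def] TS)
  qed
  have h_quad: "norm (h n x) \<le> 2 * C / r\<^sup>2 * (norm (x - p))\<^sup>2" if "norm (x - p) \<le> r / 2" for n x
  proof -
    have "norm (h n x) \<le> C" if "x \<in> ball p r" for x
      using h_bd subsetD[OF r(2) that] .
    from hilbert_quadratic_estimate[OF hilbert_holomorphic_on_subset[OF h_hol r(2)] this r(1) h_der
        bounded_clinear_zero that] show ?thesis by (simp add: hp)
  qed
  \<comment> \<open>With \<open>r / 4\<close>, balls of radius \<open>\<rho>1\<close> about points
    of \<open>ball p \<rho>1\<close> stay within \<open>r / 2\<close> of \<open>p\<close>, where the
    quadratic estimate gives \<open>8 * C / r\<^sup>2 * \<rho>1\<^sup>2\<close>. A Cauchy estimate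
    divides this by \<open>\<rho>1\<close>; the second bound makes the result at most 1/2.\<close>
  define \<rho>1 where "\<rho>1 = min (r / 4) (r\<^sup>2 / (16 * C))"
  have \<rho>1: "\<rho>1 > 0" "\<rho>1 \<le> r / 4" using r C by (auto simp: \<rho>1_def)
  have \<rho>1_half: "8 * C / r\<^sup>2 * \<rho>1 \<le> 1 / 2"
  proof -
    have "8 * C / r\<^sup>2 * \<rho>1 \<le> 8 * C / r\<^sup>2 * (r\<^sup>2 / (16 * C))"
      using C by (intro mult_left_mono) (auto simp: \<rho>1_def)
    also have "\<dots> = 1 / 2" using C r by simp
    finally show ?thesis .
  qed
  have h_lip: "norm (h n a - h n b) \<le> 1 / 2 * norm (a - b)"
    if ab: "a \<in> ball p \<rho>1" "b \<in> ball p \<rho>1" for n a b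
  proof -
    have "\<exists>D. (h n has_derivative D) (at c within ball p \<rho>1) \<and> onorm D \<le> 1 / 2" if c: "c \<in> ball p \<rho>1" for c
    proof -
      have near: "norm (x - p) \<le> 2 * \<rho>1" if "x \<in> ball c \<rho>1" for x
        using c that dist_triangle[of p x c] by (simp add: dist_norm norm_minus_commute)
      then have sub: "ball c \<rho>1 \<subseteq> ball p r"
        using \<rho>1 r by (fastforce simp: dist_norm norm_minus_commute)
      have cO: "c \<in> \<Omega>" using subsetD[OF r(2) subsetD[OF sub, of c]] \<rho>1(1) by simp
      obtain D where D: "bounded_clinear D" "(h n has_derivative D) (at c)"
        by (rule hilbert_holomorphic_onD[OF h_hol \<Omega>(1) cO])
      have bd: "norm (h n x) \<le> 8 * C / r\<^sup>2 * \<rho>1\<^sup>2" if "x \<in> ball c \<rho>1" for x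
      proof -
        have "norm (h n x) \<le> 2 * C / r\<^sup>2 * (norm (x - p))\<^sup>2"
          using near[OF that] \<rho>1 by (intro h_quad) auto
        also have "\<dots> \<le> 2 * C / r\<^sup>2 * (2 * \<rho>1)\<^sup>2"
          using near[OF that] C by (intro mult_left_mono power_mono) auto
        finally show ?thesis by (simp add: power_mult_distrib)
      qed
      have "h n hilbert_holomorphic_on ball c \<rho>1"
        using hilbert_holomorphic_on_subset[OF h_hol] sub r by blast
      note cauchy = hilbert_cauchy_estimate[OF this bd \<rho>1(1) D(2,1)]
      have "norm (D v) \<le> 1 / 2 * norm v" for v
      proof -
        have "8 * C / r\<^sup>2 * \<rho>1\<^sup>2 / \<rho>1 = 8 * C / r\<^sup>2 * \<rho>1"
          using \<rho>1 by (simp add: power2_eq_square)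
        then have "norm (D v) \<le> 8 * C / r\<^sup>2 * \<rho>1 * norm v" using cauchy[of v] by simp
        also have "\<dots> \<le> 1 / 2 * norm v" using \<rho>1_half by (intro mult_right_mono) auto
        finally show ?thesis .
      qed
      then have "onorm D \<le> 1 / 2" by (intro onorm_bound) auto
      then show ?thesis using has_derivative_at_withinI[OF D(2)] by blast
    qed
    then obtain D where "\<And>c. c \<in> ball p \<rho>1 \<Longrightarrow> (h n has_derivative D c) (at c within ball p \<rho>1)"
        "\<And>c. c \<in> ball p \<rho>1 \<Longrightarrow> onorm (D c) \<le> 1 / 2"
      by metis
    then show ?thesis
      by (rule differentiable_bound[OF convex_ball _ _ ab(1,2)])
  qed
  \<comment> \<open>Orbits of points of this ball stay within \<open>3 / 2 * K * \<rho>\<close> of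
    \<open>p\<close>, hence in \<open>ball p \<rho>1\<close>, where the Lipschitz bound is available
    at all times.\<close>
  define \<rho> where "\<rho> = \<rho>1 / (2 * K + 1)"
  have \<rho>: "\<rho> > 0" "\<rho> \<le> \<rho>1"
    using \<rho>1 K(3) by (auto simp: \<rho>_def field_simps)
  have orbit: "(f ^^ n) x \<in> ball p \<rho>1" if x: "x \<in> ball p \<rho>" for n x
  proof -
    have "norm (h n x - h n p) \<le> 1 / 2 * norm (x - p)"
      using x \<rho> \<rho>1 by (intro h_lip) auto
    then have "norm ((S ^^ n) ((f ^^ n) x - p)) \<le> 3 / 2 * norm (x - p)"
      using norm_triangle_sub[of "(S ^^ n) ((f ^^ n) x - p)" "x - p"] by (simp add: hp h_def[of n x])
    then have "K * norm ((S ^^ n) ((f ^^ n) x - p)) \<le> K * (3 / 2 * norm (x - p))"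
      using K(3) by (rule mult_left_mono)
    then have "norm ((f ^^ n) x - p) \<le> K * (3 / 2 * norm (x - p))"
      using K(1)[of n "(S ^^ n) ((f ^^ n) x - p)"] by (simp add: TS)
    also have "\<dots> \<le> K * (3 / 2 * \<rho>)"
      using x K(3) by (intro mult_left_mono) (auto simp: dist_norm norm_minus_commute)
    also have "\<dots> < (2 * K + 1) * \<rho>"
      using K(3) \<rho> by (simp add: distrib_right add_nonneg_pos)
    also have "\<dots> = \<rho>1" using K(3) by (simp add: \<rho>_def)
    finally show ?thesis by (simp add: dist_norm norm_minus_commute)
  qed
  \<comment> \<open>The factor \<open>K * (K * B + B)\<close> bounds the defect of conjugating one
    application of \<open>f\<close>, before division by the number of terms. The outer
    \<open>K\<close> accounts for transporting it by powers of \<open>T\<close>; \<open>n\<close>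
    applications cost \<open>n\<close> such defects.\<close>
  define L where "L = K * (K * (K * B + B))"
  have L0: "L \<ge> 0" using K(3) Bpos by (simp add: L_def)
  define \<G> where "\<G> M = {G :: 'a \<Rightarrow> 'a.
      (\<forall>a\<in>ball p \<rho>1. \<forall>b\<in>ball p \<rho>1. norm ((G a - G b) - (a - b)) \<le> 1 / 2 * norm (a - b)) \<and>
      (\<forall>n. \<forall>a\<in>\<Omega>. norm (G ((f ^^ n) a) - (T ^^ n) (G a)) \<le> n * L / Suc M) \<and>
      (\<forall>a\<in>\<Omega>. norm (G a) \<le> K * B)}" for M :: nat
  define g where "g N a = (\<Sum>i<N. (S ^^ i) ((f ^^ i) a - p)) /\<^sub>R N" for N :: nat and a
  have g_in: "g (Suc M) \<in> \<G> M" for M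
  proof -
    define N where "N = Suc M"
    have N: "N > 0" by (simp add: N_def)
    have mean: "norm (sum u {..<N} /\<^sub>R N) \<le> c" if "\<And>i. norm (u i) \<le> c" for u :: "nat \<Rightarrow> 'a" and c
    proof -
      have "norm (sum u {..<N}) \<le> (\<Sum>i<N. c)" by (rule sum_norm_le) (rule that)
      then have "norm (sum u {..<N}) \<le> c * N" by (simp add: mult.commute)
      then have "norm (sum u {..<N}) / N \<le> c" using N by (simp add: pos_divide_le_eq)
      then show ?thesis by (simp add: divide_inverse mult.commute)
    qed
    have 1: "norm ((g N a - g N b) - (a - b)) \<le> 1 / 2 * norm (a - b)"
      if "a \<in> ball p \<rho>1" "b \<in> ball p \<rho>1" for a b
    proof -
      have "(\<Sum>i<N. h i a - h i b) = (\<Sum>i<N. (S ^^ i) ((f ^^ i) a - p)) - (\<Sum>i<N. (S ^^ i) ((f ^^ i) b - p)) - N *\<^sub>R (a - b)"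
      proof -
        have "h i a - h i b = (S ^^ i) ((f ^^ i) a - p) - (S ^^ i) ((f ^^ i) b - p) - (a - b)" for i
          by (simp add: h_def)
        then show ?thesis
          by (simp only: sum_subtractf sum_constant_scaleR card_lessThan scaleR_diff_right)
      qed
      then have "(g N a - g N b) - (a - b) = (\<Sum>i<N. h i a - h i b) /\<^sub>R N"
        using N by (simp add: g_def scaleR_diff_right)
      then show ?thesis using mean[OF h_lip[OF that]] by simp
    qed
    have 3: "norm (g N a) \<le> K * B" if "a \<in> \<Omega>" for a
      unfolding g_def by (rule mean) (rule Sf_bd[OF that])
    have step: "norm (g N (f a) - T (g N a)) \<le> K * (K * B + B) / N" if a: "a \<in> \<Omega>" for a
    proof -
      \<comment> \<open>The averages composed with \<open>f\<close> on one side and \<open>T\<close>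
        on the other are sums of \<open>s\<close> shifted by one index, so only the end terms
        survive; their difference is \<open>T (h N a)\<close>.\<close>
      define s where "s i = T ((S ^^ i) ((f ^^ i) a - p))" for i
      have "T (g N a) = (\<Sum>i<N. s i) /\<^sub>R N"
        using bounded_linear.linear[OF bounded_clinearD(1)[OF T(2)]]
        by (simp add: g_def s_def linear_scale linear_sum)
      moreover have "g N (f a) = (\<Sum>i<N. s (Suc i)) /\<^sub>R N"
        by (simp add: g_def s_def S funpow_swap1[of f])
      ultimately have "g N (f a) - T (g N a) = (s N - s 0) /\<^sub>R N"
        by (simp add: scaleR_diff_right[symmetric] sum_subtractf[symmetric] sum_lessThan_telescope)
      moreover have "norm (s N - s 0) \<le> K * (K * B + B)"
      proof -
        have "norm (T u) \<le> K * norm u" for u using K(1)[of 1 u] by simp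
        moreover have "s N - s 0 = T (h N a)"
          using bounded_clinear_simps(2)[OF T(2)] by (simp add: s_def h_def)
        ultimately show ?thesis
          using h_bd[OF a, of N] mult_left_mono[OF _ K(3)] unfolding C_def by (metis order_trans)
      qed
      ultimately show ?thesis using N by (simp add: divide_inverse_commute[symmetric] divide_right_mono)
    qed
    have 2: "norm (g N ((f ^^ n) a) - (T ^^ n) (g N a)) \<le> n * L / N" if "a \<in> \<Omega>" for n a
      using that
    proof (induction n arbitrary: a)
      case (Suc n)
      have fa: "f a \<in> \<Omega>" using Suc.prems f(1) by blast
      have "g N ((f ^^ Suc n) a) - (T ^^ Suc n) (g N a)
          = (g N ((f ^^ n) (f a)) - (T ^^ n) (g N (f a))) + (T ^^ n) (g N (f a) - T (g N a))"
        by (simp add: funpow_swap1 funpow_clinear_simps[OF T(2)])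
      also have "norm \<dots> \<le> n * L / N + K * (K * (K * B + B) / N)"
        by (rule norm_triangle_mono[OF Suc.IH[OF fa] order_trans[OF K(1) mult_left_mono[OF step[OF Suc.prems] K(3)]]])
      also have "\<dots> = Suc n * L / N"
        by (simp add: L_def distrib_right add_divide_distrib)
      finally show ?case .
    qed simp
    show ?thesis
      using 1 2 3 unfolding \<G>_def N_def[symmetric] by blast
  qed
  have conj: "\<exists>y. \<forall>m m'. norm ((f ^^ m) x - (f ^^ m') x) \<le> 2 * norm ((T ^^ m) y - (T ^^ m') y)"
    if x: "x \<in> ball p \<rho>" for x
  proof -
    have xO: "x \<in> \<Omega>" using x \<rho> \<rho>1 r by (intro subsetD[OF r(2)]) auto
    \<comment> \<open>Evaluation at the one point \<open>x\<close> turns the sets of approximate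
      conjugations into decreasing convex bounded sets of vectors.\<close>
    define V where "V M = (\<lambda>G. G x) ` \<G> M" for M
    have V_convex: "convex (V M)" for M
    proof (rule convexI)
      fix v w and s t :: real
      assume vw: "v \<in> V M" "w \<in> V M" and st: "0 \<le> s" "0 \<le> t" "s + t = 1"
      obtain G H where G: "G \<in> \<G> M" "v = G x" and H: "H \<in> \<G> M" "w = H x"
        using vw unfolding V_def by blast
      have comb: "norm (s *\<^sub>R a + t *\<^sub>R b) \<le> c" if "norm a \<le> c" "norm b \<le> c" for a b :: 'a and c
      proof -
        have "norm (s *\<^sub>R a + t *\<^sub>R b) \<le> s * c + t * c"
          by (rule norm_triangle_mono) (use that st in \<open>auto intro: mult_left_mono\<close>)
        then show ?thesis using st by (simp add: distrib_right[symmetric])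
      qed
      define F where "F a = s *\<^sub>R G a + t *\<^sub>R H a" for a
      have unit: "u = s *\<^sub>R u + t *\<^sub>R u" for u :: 'a
        using st by (simp add: scaleR_add_left[symmetric])
      have F1: "(F a - F b) - (a - b) = s *\<^sub>R ((G a - G b) - (a - b)) + t *\<^sub>R ((H a - H b) - (a - b))" for a b
        by (subst unit[of "a - b"]) (simp add: F_def algebra_simps)
      have F2: "F ((f ^^ n) a) - (T ^^ n) (F a)
          = s *\<^sub>R (G ((f ^^ n) a) - (T ^^ n) (G a)) + t *\<^sub>R (H ((f ^^ n) a) - (T ^^ n) (H a))" for n a
        by (simp add: F_def scaleR_scaleC funpow_clinear_simps[OF T(2)] scaleC_diff_right)
      have "norm ((F a - F b) - (a - b)) \<le> 1 / 2 * norm (a - b)"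
        if "a \<in> ball p \<rho>1" "b \<in> ball p \<rho>1" for a b
        unfolding F1 by (rule comb) (use G(1) H(1) that in \<open>unfold \<G>_def, blast+\<close>)
      moreover have "norm (F ((f ^^ n) a) - (T ^^ n) (F a)) \<le> n * L / Suc M" if "a \<in> \<Omega>" for n a
        unfolding F2 by (rule comb) (use G(1) H(1) that in \<open>unfold \<G>_def, blast+\<close>)
      moreover have "norm (F a) \<le> K * B" if "a \<in> \<Omega>" for a
        unfolding F_def by (rule comb) (use G(1) H(1) that in \<open>unfold \<G>_def, blast+\<close>)
      ultimately have "F \<in> \<G> M"
        unfolding \<G>_def by blast
      then show "s *\<^sub>R v + t *\<^sub>R w \<in> V M"
        unfolding V_def G(2) H(2) by (auto simp: F_def intro!: image_eqI[of _ _ F])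
    qed
    have V_dec: "decseq V"
    proof (rule decseq_SucI)
      fix M
      have "n * L / Suc (Suc M) \<le> n * L / Suc M" for n :: nat
        using L0 by (intro divide_left_mono) auto
      then have "\<G> (Suc M) \<subseteq> \<G> M"
        unfolding \<G>_def by (blast intro: order_trans)
      then show "V (Suc M) \<le> V M" unfolding V_def by blast
    qed
    have "bounded (V 0)"
      using xO unfolding bounded_iff V_def \<G>_def by blast
    \<comment> \<open>Only the values at \<open>x\<close> converge. The maps giving
      \<open>c M\<close> vary with \<open>M\<close>, and no limiting conjugation is formed: the
      estimate below involves \<open>c M\<close> only through powers of \<open>T\<close>.\<close>
    then obtain c y where c: "\<And>M. c M \<in> V M" and y: "c \<longlonglongrightarrow> y"
      using convex_decseq_convergent_selection[OF V_convex _ V_dec] g_in unfolding V_def by blast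
    have "norm ((f ^^ m) x - (f ^^ m') x) \<le> 2 * norm ((T ^^ m) y - (T ^^ m') y)" for m m'
    proof -
      define R where "R M = 2 * norm ((T ^^ m) (c M) - (T ^^ m') (c M)) + 2 * (real (m + m') * L) * (1 / Suc M)" for M
      have "norm ((f ^^ m) x - (f ^^ m') x) \<le> R M" for M
      proof -
        obtain G where G: "G \<in> \<G> M" "c M = G x"
          using c[of M] unfolding V_def by blast
        define a where "a = (f ^^ m) x"
        define b where "b = (f ^^ m') x"
        have ab: "a \<in> ball p \<rho>1" "b \<in> ball p \<rho>1" using orbit[OF x] by (auto simp: a_def b_def)
        have "norm ((G a - G b) - (a - b)) \<le> 1 / 2 * norm (a - b)"
          using G(1) ab unfolding \<G>_def by blast
        \<comment> \<open>The Lipschitz condition bounds \<open>G\<close> below as well; this is the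
          source of the factor 2 in the conclusion.\<close>
        then have 1: "norm (a - b) \<le> 2 * norm (G a - G b)"
          using norm_triangle_sub[of "a - b" "G a - G b"] by (simp add: norm_minus_commute)
        have err: "norm (G ((f ^^ n) x) - (T ^^ n) (c M)) \<le> n * L / Suc M" for n
          using G(1) xO unfolding \<G>_def G(2) by blast
        define X where "X = G a - (T ^^ m) (c M)"
        define Y where "Y = G b - (T ^^ m') (c M)"
        define Z where "Z = (T ^^ m) (c M) - (T ^^ m') (c M)"
        have eq: "G a - G b = (X - Y) + Z"
          by (simp add: X_def Y_def Z_def)
        have "norm (G a - G b) \<le> norm X + norm Y + norm Z"
          unfolding eq using norm_triangle_ineq[of "X - Y" Z] norm_triangle_ineq4[of X Y] by linarith
        also have "\<dots> \<le> m * L / Suc M + m' * L / Suc M + norm Z"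
          using err[of m] err[of m'] by (simp add: a_def b_def X_def Y_def)
        finally show ?thesis
          using 1 by (simp add: R_def Z_def a_def b_def add_divide_distrib distrib_right)
      qed
      moreover have "R \<longlonglongrightarrow> 2 * norm ((T ^^ m) y - (T ^^ m') y) + 2 * (real (m + m') * L) * 0"
        unfolding R_def
        by (intro tendsto_intros LIMSEQ_Suc[OF lim_1_over_n]
            bounded_linear.tendsto[OF bounded_clinearD(1)[OF bounded_clinear_funpow[OF T(2)]] y])
      ultimately show ?thesis
        using LIMSEQ_le_const[of R] by auto
    qed
    then show ?thesis by blast
  qed
  show thesis
    by (rule that[OF \<rho>(1) _ conj]) (use \<rho> \<rho>1 r in auto)
qed

section \<open>The theorem\<close>

theorem theorem1p1:
  fixes \<Omega> :: "'a::chilbert_space set" and p :: 'a and f :: "'a \<Rightarrow> 'a"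
  assumes "separable_space (euclidean :: 'a topology)"
    and "\<Omega> \<noteq> {}" and "open \<Omega>" and "connected \<Omega>"
    and "bounded \<Omega>" and "convex \<Omega>"
    and "p \<in> \<Omega>"
    and "f ` \<Omega> \<subseteq> \<Omega>" and "f hilbert_holomorphic_on \<Omega>"
    and "f p = p"
    and "triangularizable (differential f p)"
    and "op_spectrum (differential f p) \<subseteq> sphere 0 1"
  shows "biholomorphic f \<Omega> \<Omega>"
proof -
  note \<Omega> = \<open>open \<Omega>\<close> \<open>connected \<Omega>\<close> \<open>bounded \<Omega>\<close> \<open>convex \<Omega>\<close> \<open>p \<in> \<Omega>\<close>
  note f = \<open>f ` \<Omega> \<subseteq> \<Omega>\<close> \<open>f hilbert_holomorphic_on \<Omega>\<close> \<open>f p = p\<close>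
  obtain T where T: "bounded_clinear T" "(f has_derivative T) (at p)"
    by (rule hilbert_holomorphic_onD[OF f(2) \<Omega>(1,5)])
  have tri: "triangularizable T" and sp: "op_spectrum T \<subseteq> sphere 0 1"
    using assms(11,12) unfolding differential_eq_derivative[OF T(2,1)] .
  have fn: "(f ^^ n) x \<in> \<Omega>" if "x \<in> \<Omega>" for n x
    using funpow_into[OF f(1) that] .
  have fn_hol: "(f ^^ n) hilbert_holomorphic_on \<Omega>" for n
    by (rule hilbert_holomorphic_on_funpow[OF f(2) \<Omega>(1) f(1)])
  have fp: "(f ^^ n) p = p" for n by (induction n) (auto simp: f(3))
  obtain B where B: "\<And>x. x \<in> \<Omega> \<Longrightarrow> norm x \<le> B"
    using \<Omega>(3) unfolding bounded_iff by blast
  have B0: "0 \<le> B" by (rule order_trans[OF norm_ge_zero B[OF \<Omega>(5)]])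
  obtain r where r: "r > 0" "ball p r \<subseteq> \<Omega>"
    by (rule openE[OF \<Omega>(1,5)])
  \<comment> \<open>One constant serves every \<open>n\<close>: all iterates have the same bound on
    \<open>ball p r\<close>, and their derivatives at \<open>p\<close> are the powers of
    \<open>T\<close>.\<close>
  define K where "K = B / r"
  have K0: "K \<ge> 0" using B0 r by (simp add: K_def)
  have K: "norm ((T ^^ n) v) \<le> K * norm v" for n v
    unfolding K_def
  proof (rule hilbert_cauchy_estimate[OF hilbert_holomorphic_on_subset[OF fn_hol r(2)] _ r(1)])
    show "((f ^^ n) has_derivative T ^^ n) (at p)"
      by (rule has_derivative_funpow_fixpoint[OF T(2) f(3)])
    show "bounded_clinear (T ^^ n)"
      by (rule bounded_clinear_funpow[OF T(1)])
  qed (use B fn r(2) in blast)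
  \<comment> \<open>The spectrum avoids 0 because it lies on the unit circle.\<close>
  have "op_invertible (\<lambda>x. T x - 0 *\<^sub>C x)"
    using sp unfolding op_spectrum_def by fastforce
  then obtain S where S: "bounded_clinear S" "S \<circ> T = id" "T \<circ> S = id"
    unfolding op_invertible_def by auto
  have TS: "T (S x) = x" "S (T x) = x" for x
    using fun_cong[OF S(2), of x] fun_cong[OF S(3), of x] by auto
  obtain k where k: "\<And>n::nat. n < k n" "\<And>x. (\<lambda>n. (T ^^ k n) x) \<longlonglongrightarrow> x"
    using triangularizable_power_recurrence[OF T(1) tri sp K] by blast
  note KS = power_recurrence_inverse_bound[OF k K TS(1)]
  obtain \<rho> where \<rho>: "\<rho> > 0" "ball p \<rho> \<subseteq> \<Omega>"
    and dom: "\<And>x. x \<in> ball p \<rho> \<Longrightarrow>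
      \<exists>y. \<forall>m m'. norm ((f ^^ m) x - (f ^^ m') x) \<le> 2 * norm ((T ^^ m) y - (T ^^ m') y)"
    using orbit_dominated_by_linear_orbit[OF \<Omega>(1,3,5) f T(2,1) S(1) TS K KS K0] by blast
  have fk: "(\<lambda>n. (f ^^ k n) x) \<longlonglongrightarrow> x" if "x \<in> \<Omega>" for x
  proof -
    have "(\<lambda>n. (f ^^ k n) x - x) \<longlonglongrightarrow> 0"
    proof (rule vitali_connected[where G = "\<lambda>n x. (f ^^ k n) x - x", OF \<Omega>(1,2) _ _ \<rho> _ that])
      show "(\<lambda>x. (f ^^ k n) x - x) hilbert_holomorphic_on \<Omega>" for n
        by (rule hilbert_holomorphic_on_diff[OF fn_hol bounded_clinear_imp_holomorphic[OF bounded_clinear_ident] \<Omega>(1)])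
      show "norm ((f ^^ k n) x - x) \<le> B + B" if "x \<in> \<Omega>" for n x
        by (rule order_trans[OF norm_triangle_ineq4 add_mono[OF B[OF fn[OF that]] B[OF that]]])
      fix x assume "x \<in> ball p \<rho>"
      then obtain y where y: "\<And>m m'. norm ((f ^^ m) x - (f ^^ m') x) \<le> 2 * norm ((T ^^ m) y - (T ^^ m') y)"
        using dom by blast
      show "(\<lambda>n. (f ^^ k n) x - x) \<longlonglongrightarrow> 0"
      proof (rule Lim_null_comparison)
        show "\<forall>\<^sub>F n in sequentially. norm ((f ^^ k n) x - x) \<le> 2 * norm ((T ^^ k n) y - y)"
          using y[of _ 0] by simp
        have "(\<lambda>n. 2 * norm ((T ^^ k n) y - y)) \<longlonglongrightarrow> 2 * norm (y - y)"
          by (intro tendsto_intros k(2))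
        then show "(\<lambda>n. 2 * norm ((T ^^ k n) y - y)) \<longlonglongrightarrow> 0" by simp
      qed
    qed
    then show ?thesis by (rule Lim_null[THEN iffD2])
  qed
  \<comment> \<open>The subtraction is not truncated since \<open>n < k n\<close>. In the linear
    model these powers converge to \<open>S\<close>, which suggests the inverse of \<open>f\<close>
    as the nonlinear limit.\<close>
  define m where "m n = k n - 1" for n
  have m: "k n = Suc (m n)" for n
    using k(1)[of n] by (simp add: m_def)
  have Tm: "(\<lambda>n. (T ^^ m n) y) \<longlonglongrightarrow> S y" for y
  proof -
    have "(\<lambda>n. S ((T ^^ k n) y)) \<longlonglongrightarrow> S y"
      by (rule bounded_linear.tendsto[OF bounded_clinearD(1)[OF S(1)] k(2)])
    then show ?thesis by (simp add: m TS)
  qed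
  have "convergent (\<lambda>n. (f ^^ m n) x)" if "x \<in> \<Omega>" for x
  proof -
    \<comment> \<open>The limit is not known in advance, so the Vitali argument is applied to
      differences indexed by pairs; the product filter yields the Cauchy property.\<close>
    have "((\<lambda>i. (f ^^ m (fst i)) x - (f ^^ m (snd i)) x) \<longlongrightarrow> 0) (sequentially \<times>\<^sub>F sequentially)"
    proof (rule vitali_connected[where G = "\<lambda>i x. (f ^^ m (fst i)) x - (f ^^ m (snd i)) x", OF \<Omega>(1,2) _ _ \<rho> _ that])
      show "(\<lambda>x. (f ^^ m (fst i)) x - (f ^^ m (snd i)) x) hilbert_holomorphic_on \<Omega>" for i
        by (rule hilbert_holomorphic_on_diff[OF fn_hol fn_hol \<Omega>(1)])
      show "norm ((f ^^ m (fst i)) x - (f ^^ m (snd i)) x) \<le> B + B" if "x \<in> \<Omega>" for i x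
        by (rule order_trans[OF norm_triangle_ineq4 add_mono[OF B[OF fn[OF that]] B[OF fn[OF that]]]])
      fix x assume "x \<in> ball p \<rho>"
      then obtain y where y: "\<And>m m'. norm ((f ^^ m) x - (f ^^ m') x) \<le> 2 * norm ((T ^^ m) y - (T ^^ m') y)"
        using dom by blast
      show "((\<lambda>i. (f ^^ m (fst i)) x - (f ^^ m (snd i)) x) \<longlongrightarrow> 0) (sequentially \<times>\<^sub>F sequentially)"
      proof (rule Lim_null_comparison)
        show "\<forall>\<^sub>F i in sequentially \<times>\<^sub>F sequentially. norm ((f ^^ m (fst i)) x - (f ^^ m (snd i)) x)
            \<le> 2 * norm ((T ^^ m (fst i)) y - (T ^^ m (snd i)) y)"
          using y by simp
        have "((\<lambda>i. 2 * norm ((T ^^ m (fst i)) y - (T ^^ m (snd i)) y)) \<longlongrightarrow> 2 * norm (S y - S y))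
            (sequentially \<times>\<^sub>F sequentially)"
          by (intro tendsto_intros filterlim_compose[OF Tm filterlim_fst] filterlim_compose[OF Tm filterlim_snd])
        then show "((\<lambda>i. 2 * norm ((T ^^ m (fst i)) y - (T ^^ m (snd i)) y)) \<longlongrightarrow> 0)
            (sequentially \<times>\<^sub>F sequentially)" by simp
      qed
    qed
    then have "\<exists>N. \<forall>i\<ge>N. \<forall>j\<ge>N. dist ((f ^^ m i) x) ((f ^^ m j) x) < e" if "e > 0" for e
      using tendstoD[OF _ that] by (fastforce simp: eventually_prod_sequentially dist_norm)
    then have "Cauchy (\<lambda>n. (f ^^ m n) x)"
      by (intro metric_CauchyI)
    then show ?thesis by (rule Cauchy_convergent)
  qed
  then have "\<forall>x\<in>\<Omega>. \<exists>y. (\<lambda>n. (f ^^ m n) x) \<longlonglongrightarrow> y"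
    unfolding convergent_def by blast
  then obtain h where h: "\<And>x. x \<in> \<Omega> \<Longrightarrow> (\<lambda>n. (f ^^ m n) x) \<longlonglongrightarrow> h x"
    by metis
  have h_hol: "h hilbert_holomorphic_on \<Omega>"
    by (rule hilbert_holomorphic_on_limit[OF \<Omega>(1) fn_hol _ h, where C = B]) (use B fn in blast)
  have h_cl: "h x \<in> closure \<Omega>" if "x \<in> \<Omega>" for x
    unfolding closure_sequential
    by (rule exI[of _ "\<lambda>n. (f ^^ m n) x"]) (simp add: fn h that)
  \<comment> \<open>The set contains \<open>p\<close> and is open by continuity. On a ball inside
    \<open>\<Omega>\<close> about a point outside the set, the maximum principle forbids any value
    of \<open>h\<close> in \<open>\<Omega>\<close>, so the complement is open too.\<close>
  have "{x\<in>\<Omega>. h x \<in> \<Omega>} = \<Omega>"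
  proof (rule connected_open_exhaust[OF \<Omega>(2)])
    have "open (\<Omega> \<inter> h -` \<Omega>)"
      by (rule continuous_open_preimage[OF hilbert_holomorphic_on_imp_continuous_on[OF h_hol] \<Omega>(1,1)])
    moreover have "\<Omega> \<inter> h -` \<Omega> = {x\<in>\<Omega>. h x \<in> \<Omega>}" by auto
    ultimately show "open {x\<in>\<Omega>. h x \<in> \<Omega>}" by simp
    have "h p = p"
      using LIMSEQ_unique[OF h[OF \<Omega>(5)]] by (simp add: fp)
    then show "{x\<in>\<Omega>. h x \<in> \<Omega>} \<noteq> {}" using \<Omega>(5) by auto
    show "open (\<Omega> - {x\<in>\<Omega>. h x \<in> \<Omega>})"
      unfolding open_contains_ball
    proof
      fix x assume x: "x \<in> \<Omega> - {x\<in>\<Omega>. h x \<in> \<Omega>}"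
      then have "x \<in> \<Omega>" "h x \<notin> \<Omega>" by auto
      then obtain R where R: "R > 0" "ball x R \<subseteq> \<Omega>"
        using openE[OF \<Omega>(1)] by blast
      have "h y \<notin> \<Omega>" if y: "y \<in> ball x R" for y
      proof
        assume hy: "h y \<in> \<Omega>"
        have bd: "norm (h z) \<le> B" if "z \<in> ball x R" for z
          by (rule LIMSEQ_le_const2[OF tendsto_norm[OF h]]) (use that R B fn in blast)+
        have "h ` ball x R \<subseteq> closure \<Omega>" using h_cl R by blast
        from holomorphic_into_closure_convex[OF hilbert_holomorphic_on_subset[OF h_hol R(2)] bd \<Omega>(1,4) this y hy]
        show False using \<open>h x \<notin> \<Omega>\<close> by blast
      qed
      then show "\<exists>e>0. ball x e \<subseteq> \<Omega> - {x\<in>\<Omega>. h x \<in> \<Omega>}"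
        using R by (intro exI[of _ R]) auto
    qed
  qed auto
  then have h_in: "h x \<in> \<Omega>" if "x \<in> \<Omega>" for x using that by blast
  have fh: "f (h x) = x" if x: "x \<in> \<Omega>" for x
  proof (rule LIMSEQ_unique)
    \<comment> \<open>This is where \<open>h x \<in> \<Omega>\<close> is essential: \<open>f\<close>
      is known to be continuous only on \<open>\<Omega>\<close>, not on its closure.\<close>
    have "isCont f (h x)"
      using hilbert_holomorphic_on_imp_continuous_on[OF f(2)] \<Omega>(1) h_in[OF x]
      by (simp add: continuous_on_eq_continuous_at)
    from isCont_tendsto_compose[OF this h[OF x]]
    show "(\<lambda>n. f ((f ^^ m n) x)) \<longlonglongrightarrow> f (h x)" .
    show "(\<lambda>n. f ((f ^^ m n) x)) \<longlonglongrightarrow> x"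
      using fk[OF x] by (simp add: m)
  qed
  have hf: "h (f x) = x" if x: "x \<in> \<Omega>" for x
  proof (rule LIMSEQ_unique)
    have "f x \<in> \<Omega>" using x f(1) by blast
    from h[OF this] show "(\<lambda>n. (f ^^ m n) (f x)) \<longlonglongrightarrow> h (f x)" .
    show "(\<lambda>n. (f ^^ m n) (f x)) \<longlonglongrightarrow> x"
      using fk[OF x] by (simp add: m funpow_swap1)
  qed
  have bij: "bij_betw f \<Omega> \<Omega>"
    by (rule bij_betw_byWitness[where f' = h]) (use fh hf h_in f(1) in auto)
  have "inv_into \<Omega> f hilbert_holomorphic_on \<Omega>"
  proof (rule hilbert_holomorphic_on_cong[OF h_hol])
    fix x assume x: "x \<in> \<Omega>"
    show "inv_into \<Omega> f x = h x"
      by (rule inv_into_f_eq[OF bij_betw_imp_inj_on[OF bij] h_in[OF x] fh[OF x]])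
  qed
  with bij f(2) show ?thesis by (simp add: biholomorphic_def)
qed

end
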